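(* Let $\Gamma$ be a finite abelian group. For every $B\in\overline{\mathrm{GARI}}(\Gamma)$, the $\mathbb{Q}$-linear map $\mathrm{ganit}_v(B)$ induces a group automorphism of $(\overline{\mathrm{GARI}}(\Gamma),\times)$ and induces a Lie algebra automorphism of $(\overline{\mathrm{ARI}}(\Gamma),[\,,])$.
   Context: Moulds. $\Gamma$ is a finite abelian group, written multiplicatively. A mould is a sequence $M=(M(x_1,\dots,x_m))_{m\ge 0}$ with $M(\emptyset)\in\mathbb{Q}$ and, for $m\ge1$, $M(x_1,\dots,x_m)$ a family of rational functions $M_{\sigma_1,\dots,\sigma_m}(x_1,\dots,x_m)\in\mathbb{Q}(x_1,\dots,x_m)$ indexed by $(\sigma_1,\dots,\sigma_m)\in\Gamma^{m}$. $\overline{\mathrm{BIMU}}(\Gamma)$ denotes the set of all moulds, with variables called $v_i$ and components written $M\binom{\sigma_1,\dots,\sigma_m}{v_1,\dots,v_m}$. It is a $\mathbb{Q}$-vector space componentwise and a unital associative algebra with product $(A\times B)_{\sigma_1,\dots,\sigma_m}(x_1,\dots,x_m)=\sum_{i=0}^m A_{\sigma_1,\dots,\sigma_i}(x_1,\dots,x_i)B_{\sigma_{i+1},\dots,\sigma_m}(x_{i+1},\dots,x_m)$ and unit $I=(1,0,0,\dots)$. Put $[A,B]=A\times B-B\times A$, $\overline{\mathrm{ARI}}(\Gamma)=\{M: M(\emptyset)=0\}$ (a Lie algebra under $[\,,]$), $\overline{\mathrm{GARI}}(\Gamma)=\{M: M(\emptyset)=1\}$ (a group under $\times$). Words. Letters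 are pairs $\binom{\sigma}{v}$ with $\sigma\in\Gamma$ and $v$ a $\mathbb{Z}$-linear combination of $v_1,v_2,\dots$; words are finite sequences of letters, $\emptyset$ the empty word. For a word $\alpha=(\binom{\sigma_1}{w_1},\dots,\binom{\sigma_m}{w_m})$, $M(\alpha):=M_{\sigma_1,\dots,\sigma_m}(w_1,\dots,w_m)$ (only used when $w_1,\dots,w_m$ are linearly independent). Write $\omega_i=\binom{\sigma_i}{v_i}$ and $\mathbf v_r=(\omega_1,\dots,\omega_r)$. Flexions. For nonempty words $a=(\binom{\tau_1}{y_1},\dots,\binom{\tau_k}{y_k})$, $b=(\binom{\rho_1}{z_1},\dots,\binom{\rho_l}{z_l})$: $a\rceil_b$ is $a$ with its last letter replaced by $\binom{\tau_k\rho_1\cdots\rho_l}{y_k}$, and ${}_a\lfloor b=(\binom{\rho_1}{z_1-y_k},\dots,\binom{\rho_l}{z_l-y_k})$; moreover $a\rceil_\emptyset=a$, ${}_a\lfloor\emptyset=\emptyset$. The map $\mathrm{ganit}_v(B)$. For $B\in\overline{\mathrm{GARI}}(\Gamma)$, the $\mathbb{Q}$-linear map $\mathrm{ganit}_v(B):\overline{\mathrm{BIMU}}(\Gamma)\to\overline{\mathrm{BIMU}}(\Gamma)$ is given by $(\mathrm{ganit}_v(B)(A))(\emptyset)=A(\emptyset)$ and, for $r\ge1$, $$(\mathrm{ganit}_v(B)(A))(\mathbf v_r)=\sum_{s\ge1}\ \sum_{\substack{\mathbf v_r=a_1b_1\cdots a_sb_s\\ a_1,\dots,a_s\ne\emptyset\\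 b_1,\dots,b_{s-1}\ne\emptyset}}B({}_{a_1}\lfloor b_1)\cdots B({}_{a_s}\lfloor b_s)\,A(a_1\rceil_{b_1}\cdots a_s\rceil_{b_s}).$$ *)

theory Defs
  imports
    Complex_Main
    "HOL-Algebra.Group"
    "HOL-Library.Poly_Mapping"
    "HOL-Library.Function_Algebras"
    "HOL-Computational_Algebra.Fraction_Field"
begin

section \<open>Rational functions in countably many variables\<close>

text \<open>Polynomials over \<open>\<rat>\<close> in variables indexed by \<open>nat\<close>: an exponent vector is a finitely
  supported \<open>nat \<Rightarrow>\<^sub>0 nat\<close>. Indices start at 0, so the variable of index \<open>i\<close> is \<open>x\<^bsub>i+1\<^esub>\<close>
  (equivalently \<open>v\<^bsub>i+1\<^esub>\<close>) in the usual numbering.\<close>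

type_synonym qpoly = "(nat \<Rightarrow>\<^sub>0 nat) \<Rightarrow>\<^sub>0 rat"
type_synonym ratfun = "qpoly fract"

definition poly_in_first :: "nat \<Rightarrow> qpoly set" where
  "poly_in_first m = {p. \<forall>k \<in> Poly_Mapping.keys p. Poly_Mapping.keys k \<subseteq> {..<m}}"

definition ratfun_in_first :: "nat \<Rightarrow> ratfun set" where
  "ratfun_in_first m = {Fract p q | p q. p \<in> poly_in_first m \<and> q \<in> poly_in_first m \<and> q \<noteq> 0}"

definition const_poly :: "rat \<Rightarrow> qpoly" where
  "const_poly c = Poly_Mapping.single 0 c"

definition const_ratfun :: "rat \<Rightarrow> ratfun" where
  "const_ratfun c = Fract (const_poly c) 1"

definition monomial_subst :: "(nat \<Rightarrow> qpoly) \<Rightarrow> (nat \<Rightarrow>\<^sub>0 nat) \<Rightarrow> qpoly" where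
  "monomial_subst s k = (\<Prod>i \<in> Poly_Mapping.keys k. s i ^ Poly_Mapping.lookup k i)"

definition poly_subst :: "(nat \<Rightarrow> qpoly) \<Rightarrow> qpoly \<Rightarrow> qpoly" where
  "poly_subst s p =
     (\<Sum>k \<in> Poly_Mapping.keys p. const_poly (Poly_Mapping.lookup p k) * monomial_subst s k)"

text \<open>Substitution into a rational function. The value does not depend on the fraction
  chosen, as long as its denominator does not become zero (\<open>ratfun_subst_Fract\<close> below); if no
  such fraction exists the value is unspecified. For substitutions by linearly independent
  linear forms every nonzero denominator remains nonzero.\<close>

definition ratfun_subst :: "(nat \<Rightarrow> qpoly) \<Rightarrow> ratfun \<Rightarrow> ratfun" where
  "ratfun_subst s f =
     (THE g. \<exists>p q. f = Fract p q \<and> poly_subst s q \<noteq> 0 \<and>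
        g = Fract (poly_subst s p) (poly_subst s q))"

lemma const_poly_0 [simp]: "const_poly 0 = 0"
  by (simp add: const_poly_def)

lemma const_poly_1 [simp]: "const_poly 1 = 1"
  by (simp add: const_poly_def)

lemma const_poly_add: "const_poly (a + b) = const_poly a + const_poly b"
  by (simp add: const_poly_def single_add)

lemma const_poly_mult: "const_poly (a * b) = const_poly a * const_poly b"
  by (simp add: const_poly_def mult_single)

lemma monomial_subst_0 [simp]: "monomial_subst s 0 = 1"
  by (simp add: monomial_subst_def)

lemma monomial_subst_add: "monomial_subst s (k + l) = monomial_subst s k * monomial_subst s l"
proof -
  let ?K = "Poly_Mapping.keys k \<union> Poly_Mapping.keys l"
  have *: "monomial_subst s m = (\<Prod>i \<in> ?K. s i ^ Poly_Mapping.lookup m i)"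
    if "Poly_Mapping.keys m \<subseteq> ?K" for m :: "nat \<Rightarrow>\<^sub>0 nat"
    unfolding monomial_subst_def
    by (rule prod.mono_neutral_left[OF _ that]) (auto simp: in_keys_iff)
  show ?thesis
    unfolding *[OF Poly_Mapping.keys_add] *[OF Un_upper1] *[OF Un_upper2]
    by (simp only: lookup_add power_add prod.distrib)
qed

lemma poly_subst_superset:
  assumes "finite K" "Poly_Mapping.keys p \<subseteq> K"
  shows "poly_subst s p =
     (\<Sum>k \<in> K. const_poly (Poly_Mapping.lookup p k) * monomial_subst s k)"
  unfolding poly_subst_def
  by (rule sum.mono_neutral_left[OF assms]) (auto simp: in_keys_iff)

lemma poly_subst_0 [simp]: "poly_subst s 0 = 0"
  by (simp add: poly_subst_def)

lemma poly_subst_add: "poly_subst s (p + q) = poly_subst s p + poly_subst s q"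
proof -
  have fin: "finite (Poly_Mapping.keys p \<union> Poly_Mapping.keys q)" by simp
  show ?thesis
    unfolding poly_subst_superset[OF fin Poly_Mapping.keys_add]
      poly_subst_superset[OF fin Un_upper1] poly_subst_superset[OF fin Un_upper2]
    by (simp add: lookup_add const_poly_add distrib_right sum.distrib)
qed

lemma poly_subst_single:
  "poly_subst s (Poly_Mapping.single k c) = const_poly c * monomial_subst s k"
  using poly_subst_superset[of "{k}" "Poly_Mapping.single k c" s] by simp

lemma poly_subst_1 [simp]: "poly_subst s 1 = 1"
  using poly_subst_single[of s 0 1] by simp

lemma qpoly_induct [case_names zero add]:
  fixes p :: qpoly
  assumes zero: "P 0"
    and add: "\<And>k c p. P p \<Longrightarrow> P (Poly_Mapping.single k c + p)"
  shows "P p"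
proof (induction p rule: Poly_Mapping.update_induct)
  case (update p k c)
  then have "Poly_Mapping.update k c p = Poly_Mapping.single k c + p"
    by (intro poly_mapping_eqI)
      (auto simp: lookup_update lookup_add lookup_single in_keys_iff when_def)
  with add[OF update(3)] show ?case by simp
qed (rule zero)

lemma poly_subst_mult: "poly_subst s (p * q) = poly_subst s p * poly_subst s q"
proof (induction p rule: qpoly_induct)
  case (add k c p)
  have "poly_subst s (Poly_Mapping.single k c * q)
      = poly_subst s (Poly_Mapping.single k c) * poly_subst s q"
  proof (induction q rule: qpoly_induct)
    case (add l d q)
    then show ?case
      by (simp add: distrib_left poly_subst_add mult_single poly_subst_single const_poly_mult
          monomial_subst_add mult_ac)
  qed simp
  with add show ?case by (simp add: distrib_right poly_subst_add)
qed simp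

lemma ratfun_subst_Fract:
  assumes "poly_subst s q \<noteq> 0"
  shows "ratfun_subst s (Fract p q) = Fract (poly_subst s p) (poly_subst s q)"
  unfolding ratfun_subst_def
proof (rule the_equality)
  show "\<exists>p' q'. Fract p q = Fract p' q' \<and> poly_subst s q' \<noteq> 0 \<and>
      Fract (poly_subst s p) (poly_subst s q) = Fract (poly_subst s p') (poly_subst s q')"
    using assms by blast
next
  fix g
  assume "\<exists>p' q'. Fract p q = Fract p' q' \<and> poly_subst s q' \<noteq> 0 \<and>
      g = Fract (poly_subst s p') (poly_subst s q')"
  then obtain p' q' where *: "Fract p q = Fract p' q'" "poly_subst s q' \<noteq> 0"
    "g = Fract (poly_subst s p') (poly_subst s q')" by blast
  have "q \<noteq> 0" "q' \<noteq> 0" using assms * by auto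
  with * have "p * q' = p' * q" by (simp add: eq_fract)
  then have "poly_subst s p * poly_subst s q' = poly_subst s p' * poly_subst s q"
    by (metis poly_subst_mult)
  with * assms show "g = Fract (poly_subst s p) (poly_subst s q)"
    by (simp add: eq_fract)
qed

section \<open>Words and moulds\<close>

type_synonym linform = "nat \<Rightarrow>\<^sub>0 int"
type_synonym 'g word = "('g \<times> linform) list"

definition linform_poly :: "linform \<Rightarrow> qpoly" where
  "linform_poly w = (\<Sum>i \<in> Poly_Mapping.keys w.
     Poly_Mapping.single (Poly_Mapping.single i 1) (of_int (Poly_Mapping.lookup w i)))"

text \<open>The component of a mould at a tuple of group elements is a rational function in as many
  variables as the tuple has entries. So that equality of moulds is equality of functions,
  components at tuples with entries outside the group are required to be 0.\<close>

type_synonym 'g mould = "'g list \<Rightarrow> ratfun"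

definition BIMU :: "('g, 'x) monoid_scheme \<Rightarrow> 'g mould set" where
  "BIMU \<Gamma> = {M. (\<forall>ss. set ss \<subseteq> carrier \<Gamma> \<longrightarrow> M ss \<in> ratfun_in_first (length ss)) \<and>
                 (\<forall>ss. \<not> set ss \<subseteq> carrier \<Gamma> \<longrightarrow> M ss = 0)}"

definition ARI :: "('g, 'x) monoid_scheme \<Rightarrow> 'g mould set" where
  "ARI \<Gamma> = {M \<in> BIMU \<Gamma>. M [] = 0}"

definition GARI :: "('g, 'x) monoid_scheme \<Rightarrow> 'g mould set" where
  "GARI \<Gamma> = {M \<in> BIMU \<Gamma>. M [] = 1}"

definition mould_eval :: "'g mould \<Rightarrow> 'g word \<Rightarrow> ratfun" where
  "mould_eval M \<alpha> =
     ratfun_subst (\<lambda>i. if i < length \<alpha> then linform_poly (snd (\<alpha> ! i)) else 0)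
       (M (map fst \<alpha>))"

text \<open>The generic word with letters \<open>(\<sigma>\<^sub>i, v\<^sub>i)\<close>.\<close>

definition gen_word :: "'g list \<Rightarrow> 'g word" where
  "gen_word ss = zip ss (map (\<lambda>i. Poly_Mapping.single i 1) [0..<length ss])"

text \<open>Addition and subtraction of moulds are the pointwise operations on functions.\<close>

definition mould_scale :: "rat \<Rightarrow> 'g mould \<Rightarrow> 'g mould" where
  "mould_scale c M = (\<lambda>ss. const_ratfun c * M ss)"

definition mould_mult :: "'g mould \<Rightarrow> 'g mould \<Rightarrow> 'g mould" where
  "mould_mult A B = (\<lambda>ss. \<Sum>i \<le> length ss.
     mould_eval A (take i (gen_word ss)) * mould_eval B (drop i (gen_word ss)))"

definition mould_unit :: "'g mould" where
  "mould_unit = (\<lambda>ss. if ss = [] then 1 else 0)"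

definition mould_bracket :: "'g mould \<Rightarrow> 'g mould \<Rightarrow> 'g mould" where
  "mould_bracket A B = mould_mult A B - mould_mult B A"

definition GARI_group :: "('g, 'x) monoid_scheme \<Rightarrow> 'g mould monoid" where
  "GARI_group \<Gamma> = \<lparr>carrier = GARI \<Gamma>, mult = mould_mult, one = mould_unit\<rparr>"

section \<open>Flexions and the map ganit\<close>

text \<open>\<open>flex_left \<Gamma> a b\<close> is \<open>a\<rceil>\<^sub>b\<close> and \<open>flex_right a b\<close> is \<open>\<^sub>a\<lfloor>b\<close>; only nonempty \<open>a\<close> is relevant.\<close>

definition flex_left :: "('g, 'x) monoid_scheme \<Rightarrow> 'g word \<Rightarrow> 'g word \<Rightarrow> 'g word" where
  "flex_left \<Gamma> a b = (if b = [] then a else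
     butlast a @ [(foldl (\<lambda>x y. x \<otimes>\<^bsub>\<Gamma>\<^esub> y) (fst (last a)) (map fst b), snd (last a))])"

definition flex_right :: "'g word \<Rightarrow> 'g word \<Rightarrow> 'g word" where
  "flex_right a b = map (\<lambda>(\<rho>, z). (\<rho>, z - snd (last a))) b"

text \<open>A factorisation \<open>w = a\<^sub>1 b\<^sub>1 \<dots> a\<^sub>s b\<^sub>s\<close> with \<open>s \<ge> 1\<close> is the list of the pairs \<open>(a\<^sub>i, b\<^sub>i)\<close>.\<close>

definition flex_facts :: "'g word \<Rightarrow> ('g word \<times> 'g word) list set" where
  "flex_facts w = {fs. fs \<noteq> [] \<and> concat (map (\<lambda>(a, b). a @ b) fs) = w \<and>
     (\<forall>(a, b) \<in> set fs. a \<noteq> []) \<and> (\<forall>(a, b) \<in> set (butlast fs). b \<noteq> [])}"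

text \<open>The index set is finite, so the sum over it below is a genuine sum.\<close>

lemma finite_flex_facts: "finite (flex_facts w)"
proof (rule finite_subset)
  let ?S = "{u. set u \<subseteq> set w \<and> length u \<le> length w}"
  show "flex_facts w \<subseteq> {fs. set fs \<subseteq> ?S \<times> ?S \<and> length fs \<le> length w}"
  proof
    fix fs assume "fs \<in> flex_facts w"
    then have w: "w = concat (map (\<lambda>(a, b). a @ b) fs)"
      and ne: "\<forall>(a, b) \<in> set fs. a \<noteq> []"
      by (auto simp: flex_facts_def)
    have "length a + length b \<le> length w" "set a \<union> set b \<subseteq> set w" if "(a, b) \<in> set fs" for a b
    proof -
      have "length (a @ b) \<in> set (map length (map (\<lambda>(a, b). a @ b) fs))"
        using that by (auto intro!: rev_image_eqI)
      then have "length (a @ b) \<le> length w"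
        unfolding w length_concat by (rule member_le_sum_list) simp
      then show "length a + length b \<le> length w" by simp
      show "set a \<union> set b \<subseteq> set w" unfolding w using that by force
    qed
    then have "set fs \<subseteq> ?S \<times> ?S" by fastforce
    moreover have "length fs \<le> length w"
      unfolding w using ne
    proof (induction fs)
      case (Cons f fs)
      then show ?case by (cases f; cases "fst f") auto
    qed simp
    ultimately show "fs \<in> {fs. set fs \<subseteq> ?S \<times> ?S \<and> length fs \<le> length w}" by blast
  qed
  have "finite ?S" by (rule finite_lists_length_le) simp
  then have "finite (?S \<times> ?S)" by (rule finite_cartesian_product[OF _ \<open>finite ?S\<close>])
  then show "finite {fs. set fs \<subseteq> ?S \<times> ?S \<and> length fs \<le> length w}"
    by (rule finite_lists_length_le)
qed

definition ganit_v :: "('g, 'x) monoid_scheme \<Rightarrow> 'g mould \<Rightarrow> 'g mould \<Rightarrow> 'g mould" where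
  "ganit_v \<Gamma> B A = (\<lambda>ss.
     if ss = [] then A []
     else if set ss \<subseteq> carrier \<Gamma> then
       (\<Sum>fs \<in> flex_facts (gen_word ss).
          prod_list (map (\<lambda>(a, b). mould_eval B (flex_right a b)) fs) *
          mould_eval A (concat (map (\<lambda>(a, b). flex_left \<Gamma> a b) fs)))
     else 0)"

section \<open>Linear maps and Lie algebras on subspaces\<close>

definition linear_map_on ::
    "('k \<Rightarrow> 'a \<Rightarrow> 'a) \<Rightarrow> 'a::plus set \<Rightarrow> 'a set \<Rightarrow> ('a \<Rightarrow> 'a) \<Rightarrow> bool" where
  "linear_map_on scale V W f \<longleftrightarrow> f \<in> V \<rightarrow> W \<and>
     (\<forall>x \<in> V. \<forall>y \<in> V. f (x + y) = f x + f y) \<and> (\<forall>c. \<forall>x \<in> V. f (scale c x) = scale c (f x))"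

locale lie_algebra_on = vector_space scale
  for scale :: "'k::field \<Rightarrow> 'a::ab_group_add \<Rightarrow> 'a" +
  fixes br :: "'a \<Rightarrow> 'a \<Rightarrow> 'a" and L :: "'a set"
  assumes subspace_L: "subspace L"
    and br_closed: "x \<in> L \<Longrightarrow> y \<in> L \<Longrightarrow> br x y \<in> L"
    and br_add_left: "x \<in> L \<Longrightarrow> y \<in> L \<Longrightarrow> z \<in> L \<Longrightarrow> br (x + y) z = br x z + br y z"
    and br_add_right: "x \<in> L \<Longrightarrow> y \<in> L \<Longrightarrow> z \<in> L \<Longrightarrow> br x (y + z) = br x y + br x z"
    and br_scale_left: "x \<in> L \<Longrightarrow> y \<in> L \<Longrightarrow> br (scale c x) y = scale c (br x y)"
    and br_scale_right: "x \<in> L \<Longrightarrow> y \<in> L \<Longrightarrow> br x (scale c y) = scale c (br x y)"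
    and br_self: "x \<in> L \<Longrightarrow> br x x = 0"
    and jacobi: "x \<in> L \<Longrightarrow> y \<in> L \<Longrightarrow> z \<in> L \<Longrightarrow>
      br x (br y z) + br y (br z x) + br z (br x y) = 0"

definition lie_automorphism_on ::
    "('k::field \<Rightarrow> 'a::ab_group_add \<Rightarrow> 'a) \<Rightarrow> ('a \<Rightarrow> 'a \<Rightarrow> 'a) \<Rightarrow> 'a set \<Rightarrow> ('a \<Rightarrow> 'a) \<Rightarrow> bool" where
  "lie_automorphism_on scale br L f \<longleftrightarrow> lie_algebra_on scale br L \<and>
     linear_map_on scale L L f \<and> bij_betw f L L \<and>
     (\<forall>x \<in> L. \<forall>y \<in> L. f (br x y) = br (f x) (f y))"

end

theory Submission
  imports Defs "HOL-Library.Sublist"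
begin

text \<open>Both the mould product and \<open>ganit_v \<Gamma> B\<close> are given by formulas that commute with
  substitutions of the letters, so they hold at every word with independent linear forms. A
  factorisation \<open>a\<^sub>1 b\<^sub>1 \<dots> a\<^sub>s b\<^sub>s\<close> amounts to the choice of the letters that belong to the
  \<open>a\<^sub>i\<close>, the first letter always being chosen. Cutting the contracted word in two is the same
  as cutting the original word in front of a chosen letter or at an end, which makes
  \<open>ganit_v \<Gamma> B\<close> multiplicative. Since \<open>B [] = 1\<close>, the term without contractions is \<open>A\<close> itself
  and all others involve \<open>A\<close> in smaller depth; hence \<open>ganit_v \<Gamma> B\<close> is unipotent for the depth
  filtration, and so bijective. Right multiplication by an element of \<open>GARI\<close> is bijective
  for the same reason, which gives the inverses in that group.\<close>

section \<open>Polynomials and substitutions\<close>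

definition var :: "nat \<Rightarrow> qpoly" where
  "var i = Poly_Mapping.single (Poly_Mapping.single i 1) 1"

lemma poly_in_first_add:
  assumes "p \<in> poly_in_first n" "q \<in> poly_in_first n"
  shows "p + q \<in> poly_in_first n"
  using assms Poly_Mapping.keys_add[of p q] by (fastforce simp: poly_in_first_def)

lemma poly_in_first_diff:
  assumes "p \<in> poly_in_first n" "q \<in> poly_in_first n"
  shows "p - q \<in> poly_in_first n"
  using assms Poly_Mapping.keys_diff[of p q] by (fastforce simp: poly_in_first_def)

lemma poly_in_first_mult:
  assumes "p \<in> poly_in_first n" "q \<in> poly_in_first n"
  shows "p * q \<in> poly_in_first n"
  unfolding poly_in_first_def mem_Collect_eq
proof
  fix k assume "k \<in> Poly_Mapping.keys (p * q)"
  then obtain a b where "k = a + b" "a \<in> Poly_Mapping.keys p" "b \<in> Poly_Mapping.keys q"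
    using Poly_Mapping.keys_mult[of p q] by blast
  then show "Poly_Mapping.keys k \<subseteq> {..<n}"
    using assms Poly_Mapping.keys_add[of a b] by (fastforce simp: poly_in_first_def)
qed

lemma poly_in_first_const [simp]: "const_poly c \<in> poly_in_first n"
  by (simp add: poly_in_first_def const_poly_def)

lemma poly_in_first_0 [simp]: "0 \<in> poly_in_first n"
  by (simp add: poly_in_first_def)

lemma poly_in_first_1 [simp]: "1 \<in> poly_in_first n"
  using poly_in_first_const[of 1 n] by simp

lemma poly_in_first_var: "i < n \<Longrightarrow> var i \<in> poly_in_first n"
  by (simp add: poly_in_first_def var_def)

lemma poly_in_first_power: "p \<in> poly_in_first n \<Longrightarrow> p ^ e \<in> poly_in_first n"
  by (induction e) (auto intro: poly_in_first_mult)

lemma poly_subst_in_first: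
  assumes "\<And>i. s i \<in> poly_in_first n"
  shows "poly_subst s p \<in> poly_in_first n"
proof -
  have prod: "(\<Prod>i\<in>K. s i ^ e i) \<in> poly_in_first n" for e and K :: "nat set"
    by (induction K rule: infinite_finite_induct)
      (auto intro: poly_in_first_mult poly_in_first_power assms)
  show ?thesis
    by (induction p rule: qpoly_induct)
      (auto simp: poly_subst_add poly_subst_single monomial_subst_def
        intro!: poly_in_first_add poly_in_first_mult prod)
qed

lemma poly_subst_cong:
  assumes "p \<in> poly_in_first n" "\<And>i. i < n \<Longrightarrow> s i = s' i"
  shows "poly_subst s p = poly_subst s' p"
proof -
  have "monomial_subst s k = monomial_subst s' k" if "k \<in> Poly_Mapping.keys p" for k
    unfolding monomial_subst_def
    by (rule prod.cong) (use that assms in \<open>force simp: poly_in_first_def\<close>)+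
  then show ?thesis unfolding poly_subst_def by simp
qed

lemma poly_subst_diff: "poly_subst s (p - q) = poly_subst s p - poly_subst s q"
  using poly_subst_add[of s "p - q" q] by (simp add: algebra_simps)

lemma poly_subst_const [simp]: "poly_subst s (const_poly c) = const_poly c"
  using poly_subst_single[of s 0 c] by (simp add: const_poly_def)

lemma poly_subst_power: "poly_subst s (p ^ e) = poly_subst s p ^ e"
  by (induction e) (auto simp: poly_subst_mult)

lemma poly_subst_prod: "poly_subst s (\<Prod>i\<in>K. f i) = (\<Prod>i\<in>K. poly_subst s (f i))"
  by (induction K rule: infinite_finite_induct) (auto simp: poly_subst_mult)

lemma poly_subst_poly_subst:
  "poly_subst t (poly_subst s p) = poly_subst (\<lambda>i. poly_subst t (s i)) p"
  by (induction p rule: qpoly_induct)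
    (simp_all add: poly_subst_add poly_subst_single poly_subst_mult monomial_subst_def
      poly_subst_prod poly_subst_power)

lemma monomial_subst_single: "monomial_subst s (Poly_Mapping.single i e) = s i ^ e"
  by (cases "e = 0") (simp_all add: monomial_subst_def)

lemma poly_subst_var [simp]: "poly_subst s (var i) = s i"
  unfolding var_def poly_subst_single monomial_subst_single by simp

lemma monomial_subst_var: "monomial_subst var k = Poly_Mapping.single k 1"
proof (induction k rule: Poly_Mapping.update_induct)
  case (update k i e)
  then have eq: "Poly_Mapping.update i e k = Poly_Mapping.single i e + k"
    by (intro poly_mapping_eqI)
      (auto simp: lookup_update lookup_add lookup_single in_keys_iff when_def)
  have "var i ^ e = Poly_Mapping.single (Poly_Mapping.single i e) 1"
  proof (induction e)
    case (Suc e)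
    have "Poly_Mapping.single i (Suc e) = Poly_Mapping.single i 1 + Poly_Mapping.single i e"
      by (simp flip: single_add)
    with Suc show ?case by (simp add: var_def mult_single)
  qed simp
  with update(3) show ?case
    unfolding eq monomial_subst_add monomial_subst_single by (simp add: mult_single)
qed simp

lemma poly_subst_var_id: "poly_subst var p = p"
  by (induction p rule: qpoly_induct)
    (simp_all add: poly_subst_add poly_subst_single monomial_subst_var const_poly_def mult_single)

section \<open>Linear forms as polynomials\<close>

lemma linform_poly_superset:
  assumes "finite K" "Poly_Mapping.keys w \<subseteq> K"
  shows "linform_poly w = (\<Sum>i\<in>K. Poly_Mapping.single (Poly_Mapping.single i 1)
    (of_int (Poly_Mapping.lookup w i)))"
  unfolding linform_poly_def
  by (rule sum.mono_neutral_left[OF assms]) (auto simp: in_keys_iff)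

lemma linform_poly_diff: "linform_poly (x - y) = linform_poly x - linform_poly y"
proof -
  have fin: "finite (Poly_Mapping.keys x \<union> Poly_Mapping.keys y)" by simp
  show ?thesis
    unfolding linform_poly_superset[OF fin Poly_Mapping.keys_diff]
      linform_poly_superset[OF fin Un_upper1] linform_poly_superset[OF fin Un_upper2]
    by (simp add: lookup_minus single_diff sum_subtractf)
qed

lemma linform_poly_single: "linform_poly (Poly_Mapping.single i 1) = var i"
  using linform_poly_superset[of "{i}" "Poly_Mapping.single i 1"] by (simp add: var_def)

section \<open>Rational functions\<close>

lemma ratfun_in_firstE:
  assumes "f \<in> ratfun_in_first n"
  obtains p q where "f = Fract p q" "p \<in> poly_in_first n" "q \<in> poly_in_first n" "q \<noteq> 0"
  using assms by (auto simp: ratfun_in_first_def)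

lemma ratfun_in_firstI:
  "p \<in> poly_in_first n \<Longrightarrow> q \<in> poly_in_first n \<Longrightarrow> q \<noteq> 0 \<Longrightarrow> Fract p q \<in> ratfun_in_first n"
  by (auto simp: ratfun_in_first_def)

lemma ratfun_in_first_0 [simp]: "0 \<in> ratfun_in_first n"
  unfolding Zero_fract_def by (rule ratfun_in_firstI) simp_all

lemma ratfun_in_first_1 [simp]: "1 \<in> ratfun_in_first n"
  unfolding One_fract_def by (rule ratfun_in_firstI) simp_all

lemma ratfun_in_first_const [simp]: "const_ratfun c \<in> ratfun_in_first n"
  unfolding const_ratfun_def by (rule ratfun_in_firstI) simp_all

lemma ratfun_in_first_add:
  assumes "f \<in> ratfun_in_first n" "g \<in> ratfun_in_first n"
  shows "f + g \<in> ratfun_in_first n"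
  using assms
  by (auto elim!: ratfun_in_firstE intro!: ratfun_in_firstI poly_in_first_add poly_in_first_mult)

lemma ratfun_in_first_diff:
  assumes "f \<in> ratfun_in_first n" "g \<in> ratfun_in_first n"
  shows "f - g \<in> ratfun_in_first n"
  using assms
  by (auto elim!: ratfun_in_firstE intro!: ratfun_in_firstI poly_in_first_diff poly_in_first_mult)

lemma ratfun_in_first_mult:
  assumes "f \<in> ratfun_in_first n" "g \<in> ratfun_in_first n"
  shows "f * g \<in> ratfun_in_first n"
  using assms
  by (auto elim!: ratfun_in_firstE intro!: ratfun_in_firstI poly_in_first_mult)

lemma ratfun_in_first_sum:
  "(\<And>i. i \<in> K \<Longrightarrow> f i \<in> ratfun_in_first n) \<Longrightarrow> sum f K \<in> ratfun_in_first n"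
  by (induction K rule: infinite_finite_induct) (auto intro: ratfun_in_first_add)

lemma const_ratfun_0 [simp]: "const_ratfun 0 = 0"
  by (simp add: const_ratfun_def fract_collapse)

lemma const_ratfun_1 [simp]: "const_ratfun 1 = 1"
  by (simp add: const_ratfun_def fract_collapse)

lemma const_ratfun_add: "const_ratfun (a + b) = const_ratfun a + const_ratfun b"
  by (simp add: const_ratfun_def const_poly_add)

lemma const_ratfun_mult: "const_ratfun (a * b) = const_ratfun a * const_ratfun b"
  by (simp add: const_ratfun_def const_poly_mult)

text \<open>Substitution is only a partial operation on fractions; as a relation it is compatible
  with the ring operations without side conditions.\<close>

definition subst_to :: "(nat \<Rightarrow> qpoly) \<Rightarrow> ratfun \<Rightarrow> ratfun \<Rightarrow> bool" where
  "subst_to s f g \<longleftrightarrow>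
     (\<exists>p q. f = Fract p q \<and> poly_subst s q \<noteq> 0 \<and> g = Fract (poly_subst s p) (poly_subst s q))"

lemma subst_toI:
  "poly_subst s q \<noteq> 0 \<Longrightarrow> subst_to s (Fract p q) (Fract (poly_subst s p) (poly_subst s q))"
  by (auto simp: subst_to_def)

lemma subst_toE:
  assumes "subst_to s f g"
  obtains p q where "f = Fract p q" "q \<noteq> 0" "poly_subst s q \<noteq> 0"
    "g = Fract (poly_subst s p) (poly_subst s q)"
  using assms unfolding subst_to_def by (metis poly_subst_0)

text \<open>The value does not depend on the chosen fraction, so facts about the relation become
  equations for \<open>ratfun_subst\<close>.\<close>

lemma ratfun_subst_eq: "subst_to s f g \<Longrightarrow> ratfun_subst s f = g"
  by (auto simp: subst_to_def ratfun_subst_Fract)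

lemma subst_to_const: "subst_to s (const_ratfun c) (const_ratfun c)"
  using subst_toI[of s 1 "const_poly c"] by (simp add: const_ratfun_def)

lemma subst_to_0: "subst_to s 0 0"
  using subst_to_const[of s 0] by simp

lemma subst_to_1: "subst_to s 1 1"
  using subst_to_const[of s 1] by simp

lemma subst_to_add:
  assumes "subst_to s f f'" "subst_to s g g'"
  shows "subst_to s (f + g) (f' + g')"
proof -
  obtain p q where f: "f = Fract p q" "q \<noteq> 0" "poly_subst s q \<noteq> 0"
    "f' = Fract (poly_subst s p) (poly_subst s q)" by (rule subst_toE[OF assms(1)])
  obtain p' q' where g: "g = Fract p' q'" "q' \<noteq> 0" "poly_subst s q' \<noteq> 0"
    "g' = Fract (poly_subst s p') (poly_subst s q')" by (rule subst_toE[OF assms(2)])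
  show ?thesis
    using subst_toI[of s "q * q'" "p * q' + p' * q"] f g
    by (simp add: poly_subst_add poly_subst_mult)
qed

lemma subst_to_mult:
  assumes "subst_to s f f'" "subst_to s g g'"
  shows "subst_to s (f * g) (f' * g')"
proof -
  obtain p q where f: "f = Fract p q" "q \<noteq> 0" "poly_subst s q \<noteq> 0"
    "f' = Fract (poly_subst s p) (poly_subst s q)" by (rule subst_toE[OF assms(1)])
  obtain p' q' where g: "g = Fract p' q'" "q' \<noteq> 0" "poly_subst s q' \<noteq> 0"
    "g' = Fract (poly_subst s p') (poly_subst s q')" by (rule subst_toE[OF assms(2)])
  show ?thesis
    using subst_toI[of s "q * q'" "p * p'"] f g by (simp add: poly_subst_mult)
qed

section \<open>Evaluation of moulds at independent words\<close>

text \<open>Linear independence is used only through this consequence: a substitution can give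
  arbitrary values to the linear forms.\<close>

definition indep :: "linform list \<Rightarrow> bool" where
  "indep xs \<longleftrightarrow> distinct xs \<and> (\<forall>f. \<exists>t. \<forall>x\<in>set xs. poly_subst t (linform_poly x) = f x)"

lemma indep_subseq: "indep xs \<Longrightarrow> subseq ys xs \<Longrightarrow> indep ys"
  unfolding indep_def
  by (metis (no_types, lifting) distinct_nthsI notin_set_nthsI subseq_conv_nths)

text \<open>Sending \<open>y\<close> to 0 and each \<open>x\<close> to the value wanted for
  \<open>x - y\<close> realises arbitrary values of the differences. These are the linear forms of a
  right flexion.\<close>

lemma indep_diff:
  assumes "indep (y # xs)"
  shows "indep (map (\<lambda>x. x - y) xs)"
  unfolding indep_def
proof (intro conjI allI)
  show "distinct (map (\<lambda>x. x - y) xs)"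
    using assms by (auto simp: indep_def distinct_map inj_on_def)
  fix f :: "linform \<Rightarrow> qpoly"
  obtain t where t: "\<forall>x\<in>set (y # xs). poly_subst t (linform_poly x) = (if x = y then 0 else f (x - y))"
    using assms unfolding indep_def
    by (elim conjE allE[of _ "\<lambda>x. if x = y then 0 else f (x - y)"]) blast
  have "y \<notin> set xs" using assms by (simp add: indep_def)
  then have "\<forall>x\<in>set (map (\<lambda>x. x - y) xs). poly_subst t (linform_poly x) = f x"
    using t by (auto simp: linform_poly_diff poly_subst_diff)
  then show "\<exists>t. \<forall>x\<in>set (map (\<lambda>x. x - y) xs). poly_subst t (linform_poly x) = f x" by blast
qed

lemma indep_gen_word: "indep (map snd (gen_word ss))"
proof -
  have eq: "map snd (gen_word ss) = map (\<lambda>i. Poly_Mapping.single i 1) [0..<length ss]"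
    by (simp add: gen_word_def)
  have inj: "inj (\<lambda>i. Poly_Mapping.single i 1 :: linform)"
    by (auto intro!: injI dest!: arg_cong[of _ _ Poly_Mapping.keys])
  have "\<exists>t. \<forall>x\<in>set (map snd (gen_word ss)). poly_subst t (linform_poly x) = f x" for f
    unfolding eq
    \<comment> \<open>The forms of a generic word are the variables, so a substitution prescribes
      their values directly.\<close>
    by (rule exI[of _ "\<lambda>i. f (Poly_Mapping.single i 1)"]) (simp add: linform_poly_single)
  then show ?thesis
    unfolding indep_def by (simp add: eq distinct_map inj_on_subset[OF inj])
qed

section \<open>Evaluation as substitution by a word\<close>

lemma length_gen_word [simp]: "length (gen_word ss) = length ss"
  by (simp add: gen_word_def)

lemma map_fst_gen_word [simp]: "map fst (gen_word ss) = ss"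
  by (simp add: gen_word_def)

lemma gen_word_Nil_iff [simp]: "gen_word ss = [] \<longleftrightarrow> ss = []"
  by (metis length_0_conv length_gen_word)

lemma nth_gen_word: "i < length ss \<Longrightarrow> gen_word ss ! i = (ss ! i, Poly_Mapping.single i 1)"
  by (simp add: gen_word_def)

definition word_subst :: "'g word \<Rightarrow> nat \<Rightarrow> qpoly" where
  "word_subst \<alpha> = (\<lambda>i. if i < length \<alpha> then linform_poly (snd (\<alpha> ! i)) else 0)"

text \<open>Independence supplies a substitution \<open>t\<close> that undoes
  \<open>word_subst \<alpha>\<close> on the variables occurring in \<open>q\<close>, so
  \<open>q\<close> can be recovered from its image.\<close>

lemma word_subst_nonzero:
  assumes "indep (map snd \<alpha>)" "q \<in> poly_in_first (length \<alpha>)" "q \<noteq> 0"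
  shows "poly_subst (word_subst \<alpha>) q \<noteq> 0"
proof
  assume zero: "poly_subst (word_subst \<alpha>) q = 0"
  let ?xs = "map snd \<alpha>"
  \<comment> \<open>The form at position \<open>i\<close> is sent to \<open>var i\<close>;
    distinctness of the forms makes \<open>i\<close> the only position described by
    \<open>THE\<close>.\<close>
  obtain t where t: "\<forall>x\<in>set ?xs. poly_subst t (linform_poly x)
      = var (THE i. i < length ?xs \<and> ?xs ! i = x)"
    using assms(1) unfolding indep_def by meson
  have "poly_subst t (word_subst \<alpha> i) = var i" if "i < length \<alpha>" for i
  proof -
    have "(THE j. j < length ?xs \<and> ?xs ! j = ?xs ! i) = i"
      by (rule the_equality)
        (use that assms(1) in \<open>auto simp: indep_def distinct_conv_nth simp del: nth_map\<close>)
    moreover have "?xs ! i \<in> set ?xs" using that by (intro nth_mem) simp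
    ultimately show ?thesis using t that by (simp add: word_subst_def)
  qed
  then have "poly_subst t (poly_subst (word_subst \<alpha>) q) = poly_subst var q"
    unfolding poly_subst_poly_subst by (intro poly_subst_cong[OF assms(2)])
  with zero assms(3) show False by (simp add: poly_subst_var_id)
qed

lemma BIMU_in_first: "M \<in> BIMU \<Gamma> \<Longrightarrow> M ss \<in> ratfun_in_first (length ss)"
  by (cases "set ss \<subseteq> carrier \<Gamma>") (auto simp: BIMU_def)

lemma BIMU_E:
  assumes "M \<in> BIMU \<Gamma>"
  obtains p q where "M ss = Fract p q" "p \<in> poly_in_first (length ss)"
    "q \<in> poly_in_first (length ss)" "q \<noteq> 0"
  using ratfun_in_firstE[OF BIMU_in_first[OF assms]] by metis

text \<open>The denominator survives the substitution by an independent word, so the unspecified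
  case of \<open>ratfun_subst\<close> does not arise.\<close>

lemma subst_to_mould_eval:
  assumes M: "M \<in> BIMU \<Gamma>" and \<alpha>: "indep (map snd \<alpha>)"
  shows "subst_to (word_subst \<alpha>) (M (map fst \<alpha>)) (mould_eval M \<alpha>)"
proof -
  obtain p q where pq: "M (map fst \<alpha>) = Fract p q" "q \<in> poly_in_first (length \<alpha>)" "q \<noteq> 0"
    using BIMU_E[OF M, of "map fst \<alpha>"] by (metis length_map)
  with word_subst_nonzero[OF \<alpha>] have nz: "poly_subst (word_subst \<alpha>) q \<noteq> 0" by blast
  then show ?thesis
    unfolding mould_eval_def word_subst_def[symmetric] pq ratfun_subst_Fract[OF nz]
    by (rule subst_toI)
qed

text \<open>A relation, since the image of a linear form under \<open>s\<close> is a polynomial that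
  need not come from another linear form.\<close>

definition letter_subst :: "(nat \<Rightarrow> qpoly) \<Rightarrow> 'g \<times> linform \<Rightarrow> 'g \<times> linform \<Rightarrow> bool" where
  "letter_subst s x y \<longleftrightarrow>
     fst x = fst y \<and> poly_subst s (linform_poly (snd x)) = linform_poly (snd y)"

text \<open>Every word is the image of the generic word under its own substitution; formulas at
  generic words are carried over to \<open>w\<close> along this fact.\<close>

lemma letter_subst_gen_word: "list_all2 (letter_subst (word_subst w)) (gen_word (map fst w)) w"
  by (simp add: list_all2_conv_all_nth nth_gen_word letter_subst_def linform_poly_single
      word_subst_def)

lemma letter_subst_map_fst: "list_all2 (letter_subst s) v w \<Longrightarrow> map fst v = map fst w"
  by (induction rule: list_all2_induct) (auto simp: letter_subst_def)

text \<open>On the variables below the common length, \<open>word_subst \<alpha>\<close> followed by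
  \<open>s\<close> is \<open>word_subst \<beta>\<close>. Independence of both words keeps both
  denominators nonzero.\<close>

lemma mould_eval_subst:
  assumes M: "M \<in> BIMU \<Gamma>" and "indep (map snd \<alpha>)" "indep (map snd \<beta>)"
    and rel: "list_all2 (letter_subst s) \<alpha> \<beta>"
  shows "subst_to s (mould_eval M \<alpha>) (mould_eval M \<beta>)"
proof -
  have len: "length \<alpha> = length \<beta>" using rel by (rule list_all2_lengthD)
  obtain p q where pq: "M (map fst \<alpha>) = Fract p q" "p \<in> poly_in_first (length \<alpha>)"
    "q \<in> poly_in_first (length \<alpha>)" "q \<noteq> 0"
    using BIMU_E[OF M, of "map fst \<alpha>"] by (metis length_map)
  have nz: "poly_subst (word_subst \<alpha>) q \<noteq> 0" "poly_subst (word_subst \<beta>) q \<noteq> 0"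
    using pq(3,4) by (simp_all add: word_subst_nonzero assms(2,3) len)
  have comp: "poly_subst s (poly_subst (word_subst \<alpha>) r) = poly_subst (word_subst \<beta>) r"
    if "r \<in> poly_in_first (length \<alpha>)" for r
    unfolding poly_subst_poly_subst
    by (rule poly_subst_cong[OF that])
      (use rel in \<open>auto simp: word_subst_def list_all2_conv_all_nth letter_subst_def\<close>)
  have "mould_eval M \<alpha> = Fract (poly_subst (word_subst \<alpha>) p) (poly_subst (word_subst \<alpha>) q)"
    "mould_eval M \<beta> = Fract (poly_subst (word_subst \<beta>) p) (poly_subst (word_subst \<beta>) q)"
    using pq nz letter_subst_map_fst[OF rel]
    by (simp_all add: mould_eval_def ratfun_subst_Fract flip: word_subst_def)
  then show ?thesis
    using nz comp pq subst_toI[of s "poly_subst (word_subst \<alpha>) q"] by metis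
qed

lemma mould_eval_gen_word [simp]:
  assumes "M \<in> BIMU \<Gamma>"
  shows "mould_eval M (gen_word ss) = M ss"
proof -
  obtain p q where pq: "M ss = Fract p q" "p \<in> poly_in_first (length ss)"
    "q \<in> poly_in_first (length ss)" "q \<noteq> 0" by (rule BIMU_E[OF assms])
  have id: "poly_subst (word_subst (gen_word ss)) r = r" if "r \<in> poly_in_first (length ss)" for r
    using poly_subst_cong[OF that, of "word_subst (gen_word ss)" var]
    by (simp add: poly_subst_var_id word_subst_def nth_gen_word linform_poly_single)
  show ?thesis
    unfolding mould_eval_def word_subst_def[symmetric] map_fst_gen_word pq(1)
    using pq by (subst ratfun_subst_Fract) (simp_all add: id)
qed

lemma mould_eval_Nil: "M \<in> BIMU \<Gamma> \<Longrightarrow> mould_eval M [] = M []"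
  using mould_eval_gen_word[of M \<Gamma> "[]"] by (simp add: gen_word_def)

lemma mould_eval_0: "M (map fst \<alpha>) = 0 \<Longrightarrow> mould_eval M \<alpha> = 0"
  unfolding mould_eval_def using ratfun_subst_eq[OF subst_to_0] by simp

lemma mould_eval_in_first:
  assumes M: "M \<in> BIMU \<Gamma>" and "indep (map snd \<alpha>)"
    and lin: "\<And>x. x \<in> set \<alpha> \<Longrightarrow> linform_poly (snd x) \<in> poly_in_first n"
  shows "mould_eval M \<alpha> \<in> ratfun_in_first n"
proof -
  obtain p q where pq: "M (map fst \<alpha>) = Fract p q" "q \<in> poly_in_first (length \<alpha>)" "q \<noteq> 0"
    using BIMU_E[OF M, of "map fst \<alpha>"] by (metis length_map)
  have "word_subst \<alpha> i \<in> poly_in_first n" for i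
    using lin by (auto simp: word_subst_def)
  then show ?thesis
    unfolding mould_eval_def word_subst_def[symmetric] pq(1)
    using word_subst_nonzero[OF assms(2)] pq
    by (auto simp: ratfun_subst_Fract intro!: ratfun_in_firstI poly_subst_in_first)
qed

lemma mould_eval_add:
  assumes "M \<in> BIMU \<Gamma>" "N \<in> BIMU \<Gamma>" "indep (map snd \<alpha>)"
  shows "mould_eval (M + N) \<alpha> = mould_eval M \<alpha> + mould_eval N \<alpha>"
  using ratfun_subst_eq[OF subst_to_add[OF assms(1,2)[THEN subst_to_mould_eval, OF assms(3)]]]
  by (simp add: mould_eval_def[of "M + N"] flip: word_subst_def)

lemma mould_eval_scale:
  assumes "M \<in> BIMU \<Gamma>" "indep (map snd \<alpha>)"
  shows "mould_eval (mould_scale c M) \<alpha> = const_ratfun c * mould_eval M \<alpha>"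
  unfolding mould_eval_def[of "mould_scale c M"] word_subst_def[symmetric]
  unfolding mould_scale_def
  by (rule ratfun_subst_eq[OF subst_to_mult[OF subst_to_const subst_to_mould_eval[OF assms]]])

text \<open>Transfer principle: the component of \<open>F\<close> is the value of the formula
  \<open>\<Phi>\<close> at the generic word, and evaluation at \<open>w\<close> substitutes into
  this component. If \<open>\<Phi>\<close> commutes with that substitution, the formula also holds
  at \<open>w\<close>.\<close>

lemma mould_eval_equivariant:
  assumes "F (map fst w) = \<Phi> (gen_word (map fst w))"
    and "subst_to (word_subst w) (\<Phi> (gen_word (map fst w))) (\<Phi> w)"
  shows "mould_eval F w = \<Phi> w"
  using ratfun_subst_eq[OF assms(2)] assms(1) by (simp add: mould_eval_def word_subst_def)

section \<open>Deconcatenation product and flexion sums\<close>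

text \<open>Defined for arbitrary functions on words, so that the algebra of cuts is separated from
  substitutions and independence.\<close>

definition conv :: "('a list \<Rightarrow> 'r::comm_ring_1) \<Rightarrow> ('a list \<Rightarrow> 'r) \<Rightarrow> 'a list \<Rightarrow> 'r" where
  "conv \<phi> \<psi> w = (\<Sum>i\<le>length w. \<phi> (take i w) * \<psi> (drop i w))"

lemma conv_Nil [simp]: "conv \<phi> \<psi> [] = \<phi> [] * \<psi> []"
  by (simp add: conv_def)

lemma conv_Cons:
  "conv \<phi> \<psi> (x # w) = \<phi> [] * \<psi> (x # w) + conv (\<lambda>v. \<phi> (x # v)) \<psi> w"
  by (simp add: conv_def sum.atMost_Suc_shift del: sum.atMost_Suc)

lemma conv_cong:
  assumes "\<And>i. i \<le> length w \<Longrightarrow> \<phi> (take i w) = \<phi>' (take i w)"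
    and "\<And>i. i \<le> length w \<Longrightarrow> \<psi> (drop i w) = \<psi>' (drop i w)"
  shows "conv \<phi> \<psi> w = conv \<phi>' \<psi>' w"
  unfolding conv_def using assms by simp

lemma conv_add_left: "conv (\<lambda>v. \<phi> v + \<psi> v) \<chi> w = conv \<phi> \<chi> w + conv \<psi> \<chi> w"
  by (simp add: conv_def distrib_right sum.distrib)

lemma conv_add_right: "conv \<chi> (\<lambda>v. \<phi> v + \<psi> v) w = conv \<chi> \<phi> w + conv \<chi> \<psi> w"
  by (simp add: conv_def distrib_left sum.distrib)

lemma conv_scale_left: "conv (\<lambda>v. c * \<phi> v) \<psi> w = c * conv \<phi> \<psi> w"
  by (simp add: conv_def sum_distrib_left mult_ac)

lemma conv_scale_right: "conv \<phi> (\<lambda>v. c * \<psi> v) w = c * conv \<phi> \<psi> w"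
  by (simp add: conv_def sum_distrib_left mult_ac)

text \<open>Splitting off the cut before the first letter leaves a product in which
  \<open>\<phi>\<close> has absorbed that letter; therefore the induction keeps
  \<open>\<phi>\<close> arbitrary.\<close>

lemma conv_assoc: "conv (conv \<phi> \<psi>) \<chi> w = conv \<phi> (conv \<psi> \<chi>) w"
proof (induction w arbitrary: \<phi>)
  case (Cons x w)
  have "conv (conv \<phi> \<psi>) \<chi> (x # w) = \<phi> [] * \<psi> [] * \<chi> (x # w)
      + conv (\<lambda>v. \<phi> [] * \<psi> (x # v) + conv (\<lambda>u. \<phi> (x # u)) \<psi> v) \<chi> w"
    by (simp add: conv_Cons)
  also have "\<dots> = \<phi> [] * conv \<psi> \<chi> (x # w) + conv (\<lambda>u. \<phi> (x # u)) (conv \<psi> \<chi>) w"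
    by (simp add: conv_add_left conv_scale_left Cons[of "\<lambda>u. \<phi> (x # u)"] conv_Cons algebra_simps)
  finally show ?case by (simp add: conv_Cons)
qed (simp add: mult_ac)

text \<open>In a factorisation \<open>a\<^sub>1 b\<^sub>1 \<dots> a\<^sub>s b\<^sub>s\<close> every letter of an \<open>a\<^sub>i\<close> except the last one may be
  regarded as followed by an empty \<open>b\<close>. Factors with empty \<open>b\<close> contribute \<open>1\<close>, so the sum
  defining the flexion operator becomes a sum over all factorisations into letters, each
  followed by a possibly empty word; \<open>\<beta>\<close> is the weight and \<open>\<delta>\<close> the contraction of such a
  pair.\<close>

fun flex_sum ::
    "('a \<Rightarrow> 'a list \<Rightarrow> 'r::comm_ring_1) \<Rightarrow> ('a \<Rightarrow> 'a list \<Rightarrow> 'a) \<Rightarrow> 'a list \<Rightarrow> ('a list \<Rightarrow> 'r) \<Rightarrow> 'r"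
  where
    "flex_sum \<beta> \<delta> [] \<phi> = \<phi> []"
  | "flex_sum \<beta> \<delta> (x # u) \<phi> = (\<Sum>k\<le>length u. \<beta> x (take k u) *
       flex_sum \<beta> \<delta> (drop k u) (\<lambda>v. \<phi> (\<delta> x (take k u) # v)))"

lemma flex_sum_add:
  "flex_sum \<beta> \<delta> w (\<lambda>v. \<phi> v + \<psi> v) = flex_sum \<beta> \<delta> w \<phi> + flex_sum \<beta> \<delta> w \<psi>"
  by (induction \<beta> \<delta> w \<phi> arbitrary: \<psi> rule: flex_sum.induct)
    (simp_all add: distrib_left sum.distrib)

lemma flex_sum_scale: "flex_sum \<beta> \<delta> w (\<lambda>v. c * \<phi> v) = c * flex_sum \<beta> \<delta> w \<phi>"
  by (induction \<beta> \<delta> w \<phi> rule: flex_sum.induct)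
    (simp_all add: sum_distrib_left mult_ac)

text \<open>The first letter \<open>x\<close> absorbs \<open>k\<close> letters of \<open>u\<close>.
  A cut of the contracted word lies either before its first letter or behind it; in the second case
  it cuts the rest of \<open>u\<close> after some \<open>j\<close> letters. The double sum then
  regroups by the cut position \<open>k + j\<close> in \<open>u\<close>.\<close>

lemma flex_sum_conv:
  "flex_sum \<beta> \<delta> w (conv \<phi> \<psi>) = conv (\<lambda>v. flex_sum \<beta> \<delta> v \<phi>) (\<lambda>v. flex_sum \<beta> \<delta> v \<psi>) w"
proof (induction "length w" arbitrary: w \<phi> rule: less_induct)
  case less
  show ?case
  proof (cases w)
    case w: (Cons x u)
    let ?F = "flex_sum \<beta> \<delta>"
    let ?n = "length u"
    let ?y = "\<lambda>k. \<delta> x (take k u)"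
    \<comment> \<open>The separate term is the cut before the contracted first letter; the sum comes
      from the induction hypothesis, with \<open>\<phi>\<close> having absorbed that letter.\<close>
    have IH: "?F (drop k u) (\<lambda>v. conv \<phi> \<psi> (?y k # v)) = \<phi> [] * ?F (drop k u) (\<lambda>v. \<psi> (?y k # v)) +
        (\<Sum>j\<le>?n - k. ?F (take j (drop k u)) (\<lambda>v. \<phi> (?y k # v)) * ?F (drop (k + j) u) \<psi>)" for k
    proof -
      have "?F (drop k u) (conv (\<lambda>v. \<phi> (?y k # v)) \<psi>) = (\<Sum>j\<le>?n - k.
          ?F (take j (drop k u)) (\<lambda>v. \<phi> (?y k # v)) * ?F (drop (k + j) u) \<psi>)"
        by (subst less) (simp_all add: w conv_def add.commute)
      then show ?thesis by (simp add: conv_Cons flex_sum_add flex_sum_scale)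
    qed
    have "?F w (conv \<phi> \<psi>) = (\<Sum>k\<le>?n. \<beta> x (take k u) *
        (\<phi> [] * ?F (drop k u) (\<lambda>v. \<psi> (?y k # v)) +
        (\<Sum>j\<le>?n - k. ?F (take j (drop k u)) (\<lambda>v. \<phi> (?y k # v)) * ?F (drop (k + j) u) \<psi>)))"
      unfolding w flex_sum.simps IH ..
    also have "\<dots> = \<phi> [] * ?F w \<psi> + (\<Sum>k\<le>?n. \<Sum>j\<le>?n - k.
        \<beta> x (take k u) * ?F (take j (drop k u)) (\<lambda>v. \<phi> (?y k # v)) * ?F (drop (k + j) u) \<psi>)"
      by (simp add: w distrib_left sum.distrib sum_distrib_left mult_ac)
    also have "(\<Sum>k\<le>?n. \<Sum>j\<le>?n - k.
        \<beta> x (take k u) * ?F (take j (drop k u)) (\<lambda>v. \<phi> (?y k # v)) * ?F (drop (k + j) u) \<psi>)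
      = (\<Sum>(k, j)\<in>{(k, j). k + j \<le> ?n}.
        \<beta> x (take k u) * ?F (take j (drop k u)) (\<lambda>v. \<phi> (?y k # v)) * ?F (drop (k + j) u) \<psi>)"
      by (subst sum.Sigma) (auto intro!: sum.cong)
    \<comment> \<open>Here \<open>m = k + j\<close>; for fixed \<open>m\<close> the sum over
      \<open>k\<close> is the recursion for the prefix \<open>x # take m u\<close>.\<close>
    also have "\<dots> = (\<Sum>m\<le>?n. \<Sum>k\<le>m.
        \<beta> x (take k u) * ?F (take (m - k) (drop k u)) (\<lambda>v. \<phi> (?y k # v)) * ?F (drop m u) \<psi>)"
      by (subst sum.triangle_reindex_eq) simp
    also have "\<dots> = conv (\<lambda>v. ?F (x # v) \<phi>) (\<lambda>v. ?F v \<psi>) u"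
      unfolding conv_def
    proof (rule sum.cong)
      fix m assume "m \<in> {..?n}"
      then show "(\<Sum>k\<le>m. \<beta> x (take k u) * ?F (take (m - k) (drop k u)) (\<lambda>v. \<phi> (?y k # v)) *
          ?F (drop m u) \<psi>) = ?F (x # take m u) \<phi> * ?F (drop m u) \<psi>"
        by (auto simp: sum_distrib_right min_def drop_take intro!: sum.cong)
    qed simp
    finally show ?thesis by (simp add: w conv_Cons)
  qed simp
qed

text \<open>The contractions keep the second components of the letters, so the words at which
  \<open>\<phi>\<close> is evaluated have subsequences of the second components of \<open>w\<close>.\<close>

lemma flex_sum_rel:
  fixes \<beta> \<beta>' :: "'a \<times> 'b \<Rightarrow> ('a \<times> 'b) list \<Rightarrow> 'r::comm_ring_1"
  assumes zero: "Q 0 0"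
    and add: "\<And>a a' b b'. Q a a' \<Longrightarrow> Q b b' \<Longrightarrow> Q (a + b) (a' + b')"
    and mult: "\<And>a a' b b'. Q a a' \<Longrightarrow> Q b b' \<Longrightarrow> Q (a * b) (a' * b')"
    and L: "\<And>x x' b b'. L x x' \<Longrightarrow> list_all2 L b b' \<Longrightarrow> L (\<delta> x b) (\<delta> x' b')"
    and snd: "\<And>x b. snd (\<delta> x b) = snd x"
    and "list_all2 L w w'"
    and \<beta>: "\<And>x x' b b'. L x x' \<Longrightarrow> list_all2 L b b' \<Longrightarrow> subseq (map snd (x # b)) (map snd w) \<Longrightarrow>
      subseq (map snd (x' # b')) (map snd w') \<Longrightarrow> Q (\<beta> x b) (\<beta>' x' b')"
    and \<phi>: "\<And>v v'. list_all2 L v v' \<Longrightarrow> subseq (map snd v) (map snd w) \<Longrightarrow>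
      subseq (map snd v') (map snd w') \<Longrightarrow> Q (\<phi> v) (\<phi>' v')"
  shows "Q (flex_sum \<beta> \<delta> w \<phi>) (flex_sum \<beta>' \<delta> w' \<phi>')"
  using assms(6-8)
proof (induction "length w" arbitrary: w w' \<phi> \<phi>' rule: less_induct)
  case less
  show ?case
  proof (cases w)
    case Nil
    with less show ?thesis by simp
  next
    case w: (Cons x u)
    then obtain x' u' where w': "w' = x' # u'" and x: "L x x'" and u: "list_all2 L u u'"
      using less.prems(1) by (auto simp: list_all2_Cons1)
    have len: "length u' = length u" using u by (simp add: list_all2_lengthD)
    have sub: "subseq xs (map snd (drop k v)) \<Longrightarrow> subseq xs (map snd v)" for xs k and v :: "('a \<times> 'b) list"
      by (metis drop_map subseq_drop_many append_take_drop_id)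
    show ?thesis
      unfolding w w' flex_sum.simps len
    proof (rule sum.related[where R = Q])
      show "\<forall>k\<in>{..length u}.
        Q (\<beta> x (take k u) * flex_sum \<beta> \<delta> (drop k u) (\<lambda>v. \<phi> (\<delta> x (take k u) # v)))
          (\<beta>' x' (take k u') * flex_sum \<beta>' \<delta> (drop k u') (\<lambda>v. \<phi>' (\<delta> x' (take k u') # v)))"
      proof
        fix k
        have tk: "list_all2 L (take k u) (take k u')" using u by (rule list_all2_takeI)
        have sub_take: "subseq (map snd (z # take k v)) (map snd (z # v))"
          for z and v :: "('a \<times> 'b) list"
          by (metis append_take_drop_id map_append list.simps(9) subseq_Cons2 subseq_rev_drop_many
              subseq_order.order_refl)
        have "Q (\<beta> x (take k u)) (\<beta>' x' (take k u'))"
          by (rule less.prems(2)[OF x tk]) (simp_all only: w w' sub_take)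
        moreover have "Q (flex_sum \<beta> \<delta> (drop k u) (\<lambda>v. \<phi> (\<delta> x (take k u) # v)))
          (flex_sum \<beta>' \<delta> (drop k u') (\<lambda>v. \<phi>' (\<delta> x' (take k u') # v)))"
        proof (rule less.hyps)
          show "length (drop k u) < length w" by (simp add: w)
          show "list_all2 L (drop k u) (drop k u')" using u by (rule list_all2_dropI)
        next
          fix z z' b b'
          assume "L z z'" "list_all2 L b b'" and *: "subseq (map snd (z # b)) (map snd (drop k u))"
            "subseq (map snd (z' # b')) (map snd (drop k u'))"
          then show "Q (\<beta> z b) (\<beta>' z' b')"
            using *[THEN sub] by (intro less.prems(2)) (simp_all only: w w' list.map list_emb_Cons)
        next
          fix v v'
          assume v: "list_all2 L v v'" "subseq (map snd v) (map snd (drop k u))"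
            "subseq (map snd v') (map snd (drop k u'))"
          show "Q (\<phi> (\<delta> x (take k u) # v)) (\<phi>' (\<delta> x' (take k u') # v'))"
            using v(1) v(2,3)[THEN sub] L[OF x tk] by (intro less.prems(3)) (simp_all add: w w' snd)
        qed
        ultimately show "Q (\<beta> x (take k u) * flex_sum \<beta> \<delta> (drop k u) (\<lambda>v. \<phi> (\<delta> x (take k u) # v)))
          (\<beta>' x' (take k u') * flex_sum \<beta>' \<delta> (drop k u') (\<lambda>v. \<phi>' (\<delta> x' (take k u') # v)))"
          by (rule mult)
      qed
    qed (use zero add in auto)
  qed
qed

text \<open>Contraction never lengthens a word, so every argument given to \<open>\<phi>\<close> has
  at most \<open>length w\<close> letters.\<close>

lemma flex_sum_eq_0:
  "(\<And>v. length v \<le> length w \<Longrightarrow> \<phi> v = 0) \<Longrightarrow> flex_sum \<beta> \<delta> w \<phi> = 0"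
proof (induction \<beta> \<delta> w \<phi> rule: flex_sum.induct)
  case (2 \<beta> \<delta> x u \<phi>)
  have "flex_sum \<beta> \<delta> (drop k u) (\<lambda>v. \<phi> (\<delta> x (take k u) # v)) = 0" if "k \<in> {..length u}" for k
    by (rule 2(1)[OF that]) (rule 2(2), simp)
  then show ?case by simp
qed simp

text \<open>A nonempty absorbed word makes the contracted word shorter than \<open>w\<close>, where
  \<open>\<phi>\<close> vanishes. Only the term without contractions is left, and its weights are
  all 1.\<close>

lemma flex_sum_leading:
  assumes "\<And>x. \<beta> x [] = 1" "\<And>x. \<delta> x [] = x"
    and "\<And>v. length v < length w \<Longrightarrow> \<phi> v = 0"
  shows "flex_sum \<beta> \<delta> w \<phi> = \<phi> w"
  using assms(3)
proof (induction w arbitrary: \<phi>)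
  case (Cons x u)
  \<comment> \<open>With the contracted letter at most \<open>length u - k + 1\<close> letters
    remain, fewer than in \<open>x # u\<close>.\<close>
  have "flex_sum \<beta> \<delta> (drop k u) (\<lambda>v. \<phi> (\<delta> x (take k u) # v)) = 0"
    if "k \<le> length u" "k \<noteq> 0" for k
    by (rule flex_sum_eq_0) (rule Cons.prems, use that in simp)
  then have "flex_sum \<beta> \<delta> (x # u) \<phi> = (\<Sum>k\<le>length u. if k = 0 then flex_sum \<beta> \<delta> u (\<lambda>v. \<phi> (x # v)) else 0)"
    unfolding flex_sum.simps by (intro sum.cong) (auto simp: assms)
  also have "\<dots> = \<phi> (x # u)"
    using Cons.IH[of "\<lambda>v. \<phi> (x # v)"] Cons.prems by simp
  finally show ?case .
qed simp

section \<open>The algebra of moulds\<close>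

lemma BIMU_I:
  assumes "\<And>ss. M ss \<in> ratfun_in_first (length ss)"
    and "\<And>ss. \<not> set ss \<subseteq> carrier \<Gamma> \<Longrightarrow> M ss = 0"
  shows "M \<in> BIMU \<Gamma>"
  using assms by (simp add: BIMU_def)

lemma BIMU_outside: "M \<in> BIMU \<Gamma> \<Longrightarrow> \<not> set ss \<subseteq> carrier \<Gamma> \<Longrightarrow> M ss = 0"
  by (simp add: BIMU_def)

lemma BIMU_0: "0 \<in> BIMU \<Gamma>"
  by (simp add: BIMU_def)

lemma BIMU_add: "M \<in> BIMU \<Gamma> \<Longrightarrow> N \<in> BIMU \<Gamma> \<Longrightarrow> M + N \<in> BIMU \<Gamma>"
  by (simp add: BIMU_def ratfun_in_first_add)

lemma BIMU_diff: "M \<in> BIMU \<Gamma> \<Longrightarrow> N \<in> BIMU \<Gamma> \<Longrightarrow> M - N \<in> BIMU \<Gamma>"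
  by (simp add: BIMU_def ratfun_in_first_diff)

lemma BIMU_scale: "M \<in> BIMU \<Gamma> \<Longrightarrow> mould_scale c M \<in> BIMU \<Gamma>"
  by (simp add: BIMU_def mould_scale_def ratfun_in_first_mult)

lemma BIMU_unit: "mould_unit \<in> BIMU \<Gamma>"
  by (auto simp: BIMU_def mould_unit_def)

lemma mould_unit_Nil: "mould_unit [] = 1"
  by (simp add: mould_unit_def)

lemma mould_eval_unit: "mould_eval mould_unit \<alpha> = (if \<alpha> = [] then 1 else 0)"
  unfolding mould_eval_def mould_unit_def
  using ratfun_subst_eq[OF subst_to_0] ratfun_subst_eq[OF subst_to_1] by simp

lemma indep_take: "indep (map snd w) \<Longrightarrow> indep (map snd (take i w))"
  by (erule indep_subseq) (metis append_take_drop_id map_append subseq_rev_drop_many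
      subseq_order.order_refl)

lemma indep_drop: "indep (map snd w) \<Longrightarrow> indep (map snd (drop i w))"
  by (erule indep_subseq) (metis append_take_drop_id map_append subseq_drop_many
      subseq_order.order_refl)

lemma gen_word_in_first:
  "x \<in> set (gen_word ss) \<Longrightarrow> linform_poly (snd x) \<in> poly_in_first (length ss)"
  by (auto simp: in_set_conv_nth nth_gen_word linform_poly_single intro: poly_in_first_var)

lemma mould_mult_conv: "mould_mult A B ss = conv (mould_eval A) (mould_eval B) (gen_word ss)"
  by (simp add: mould_mult_def conv_def)

text \<open>Instance of the transfer principle: prefixes and suffixes of independent words are
  independent, so each factor of each summand commutes with the substitution.\<close>

lemma mould_eval_mult:
  assumes A: "A \<in> BIMU \<Gamma>" and B: "B \<in> BIMU \<Gamma>" and w: "indep (map snd w)"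
  shows "mould_eval (mould_mult A B) w = conv (mould_eval A) (mould_eval B) w"
proof (rule mould_eval_equivariant)
  let ?g = "gen_word (map fst w)" and ?s = "word_subst w"
  have len: "length ?g = length w" by simp
  have rel: "list_all2 (letter_subst ?s) ?g w" by (rule letter_subst_gen_word)
  show "subst_to ?s (conv (mould_eval A) (mould_eval B) ?g) (conv (mould_eval A) (mould_eval B) w)"
    unfolding conv_def len
    by (rule sum.related[where R = "subst_to ?s"])
      (auto intro!: subst_to_0 subst_to_add subst_to_mult mould_eval_subst[OF A]
        mould_eval_subst[OF B] indep_take indep_drop indep_gen_word w list_all2_takeI
        list_all2_dropI rel)
qed (simp add: mould_mult_conv)

lemma BIMU_mult:
  assumes A: "A \<in> BIMU \<Gamma>" and B: "B \<in> BIMU \<Gamma>"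
  shows "mould_mult A B \<in> BIMU \<Gamma>"
proof (rule BIMU_I)
  fix ss :: "'a list"
  show "mould_mult A B ss \<in> ratfun_in_first (length ss)"
    unfolding mould_mult_def
    by (intro ratfun_in_first_sum ratfun_in_first_mult mould_eval_in_first[OF A]
        mould_eval_in_first[OF B] indep_take indep_drop indep_gen_word gen_word_in_first)
      (auto dest: in_set_takeD in_set_dropD)
next
  fix ss :: "'a list"
  assume ss: "\<not> set ss \<subseteq> carrier \<Gamma>"
  \<comment> \<open>An entry outside the carrier lies in one of the two parts, and the mould
    evaluated there vanishes.\<close>
  have "mould_eval A (take i (gen_word ss)) * mould_eval B (drop i (gen_word ss)) = 0" for i
  proof (cases "set (take i ss) \<subseteq> carrier \<Gamma>")
    case True
    have "set ss = set (take i ss) \<union> set (drop i ss)"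
      by (metis append_take_drop_id set_append)
    with ss True have "\<not> set (drop i ss) \<subseteq> carrier \<Gamma>" by blast
    then have "mould_eval B (drop i (gen_word ss)) = 0"
      by (intro mould_eval_0) (simp add: BIMU_outside[OF B] flip: drop_map)
    then show ?thesis by simp
  next
    case False
    then have "mould_eval A (take i (gen_word ss)) = 0"
      by (intro mould_eval_0) (simp add: BIMU_outside[OF A] flip: take_map)
    then show ?thesis by simp
  qed
  then show "mould_mult A B ss = 0" unfolding mould_mult_def by (intro sum.neutral ballI)
qed

lemma mould_mult_assoc:
  assumes "A \<in> BIMU \<Gamma>" "B \<in> BIMU \<Gamma>" "C \<in> BIMU \<Gamma>"
  shows "mould_mult (mould_mult A B) C = mould_mult A (mould_mult B C)"
proof
  fix ss :: "'a list"
  let ?A = "mould_eval A" and ?B = "mould_eval B" and ?C = "mould_eval C" and ?g = "gen_word ss"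
  have "mould_mult (mould_mult A B) C ss = conv (conv ?A ?B) ?C ?g"
    unfolding mould_mult_conv[of _ _ ss]
    by (rule conv_cong) (simp_all add: mould_eval_mult[OF assms(1,2)] indep_take indep_gen_word)
  also have "\<dots> = conv ?A (conv ?B ?C) ?g" by (rule conv_assoc)
  also have "\<dots> = mould_mult A (mould_mult B C) ss"
    unfolding mould_mult_conv[of _ _ ss]
    by (rule conv_cong) (simp_all add: mould_eval_mult[OF assms(2,3)] indep_drop indep_gen_word)
  finally show "mould_mult (mould_mult A B) C ss = mould_mult A (mould_mult B C) ss" .
qed

lemma mould_mult_add_left:
  assumes "A \<in> BIMU \<Gamma>" "B \<in> BIMU \<Gamma>"
  shows "mould_mult (A + B) C = mould_mult A C + mould_mult B C"
proof
  fix ss :: "'a list"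
  have "conv (mould_eval (A + B)) (mould_eval C) (gen_word ss)
      = conv (\<lambda>v. mould_eval A v + mould_eval B v) (mould_eval C) (gen_word ss)"
    by (rule conv_cong) (simp_all add: mould_eval_add[OF assms] indep_take indep_gen_word)
  then show "mould_mult (A + B) C ss = (mould_mult A C + mould_mult B C) ss"
    by (simp add: mould_mult_conv conv_add_left)
qed

lemma mould_mult_add_right:
  assumes "A \<in> BIMU \<Gamma>" "B \<in> BIMU \<Gamma>"
  shows "mould_mult C (A + B) = mould_mult C A + mould_mult C B"
proof
  fix ss :: "'a list"
  have "conv (mould_eval C) (mould_eval (A + B)) (gen_word ss)
      = conv (mould_eval C) (\<lambda>v. mould_eval A v + mould_eval B v) (gen_word ss)"
    by (rule conv_cong) (simp_all add: mould_eval_add[OF assms] indep_drop indep_gen_word)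
  then show "mould_mult C (A + B) ss = (mould_mult C A + mould_mult C B) ss"
    by (simp add: mould_mult_conv conv_add_right)
qed

lemma mould_mult_scale_left:
  assumes "A \<in> BIMU \<Gamma>"
  shows "mould_mult (mould_scale c A) B = mould_scale c (mould_mult A B)"
proof
  fix ss :: "'a list"
  have "conv (mould_eval (mould_scale c A)) (mould_eval B) (gen_word ss)
      = conv (\<lambda>v. const_ratfun c * mould_eval A v) (mould_eval B) (gen_word ss)"
    by (rule conv_cong) (simp_all add: mould_eval_scale[OF assms] indep_take indep_gen_word)
  then show "mould_mult (mould_scale c A) B ss = mould_scale c (mould_mult A B) ss"
    by (simp add: mould_mult_conv conv_scale_left mould_scale_def[of c "mould_mult A B"])
qed

lemma mould_mult_scale_right:
  assumes "A \<in> BIMU \<Gamma>"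
  shows "mould_mult B (mould_scale c A) = mould_scale c (mould_mult B A)"
proof
  fix ss :: "'a list"
  have "conv (mould_eval B) (mould_eval (mould_scale c A)) (gen_word ss)
      = conv (mould_eval B) (\<lambda>v. const_ratfun c * mould_eval A v) (gen_word ss)"
    by (rule conv_cong) (simp_all add: mould_eval_scale[OF assms] indep_drop indep_gen_word)
  then show "mould_mult B (mould_scale c A) ss = mould_scale c (mould_mult B A) ss"
    by (simp add: mould_mult_conv conv_scale_right mould_scale_def[of c "mould_mult B A"])
qed

lemma mould_mult_diff_left:
  assumes "A \<in> BIMU \<Gamma>" "B \<in> BIMU \<Gamma>"
  shows "mould_mult (A - B) C = mould_mult A C - mould_mult B C"
  using mould_mult_add_left[OF BIMU_diff[OF assms] assms(2)] by (simp add: algebra_simps)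

lemma mould_mult_diff_right:
  assumes "A \<in> BIMU \<Gamma>" "B \<in> BIMU \<Gamma>"
  shows "mould_mult C (A - B) = mould_mult C A - mould_mult C B"
  using mould_mult_add_right[OF BIMU_diff[OF assms] assms(2)] by (simp add: algebra_simps)

lemma mould_mult_Nil:
  "A \<in> BIMU \<Gamma> \<Longrightarrow> B \<in> BIMU \<Gamma> \<Longrightarrow> mould_mult A B [] = A [] * B []"
  by (simp add: mould_mult_conv mould_eval_Nil gen_word_def)

lemma mould_mult_unit_left:
  assumes "A \<in> BIMU \<Gamma>"
  shows "mould_mult mould_unit A = A"
proof
  fix ss :: "'a list"
  have "mould_mult mould_unit A ss = (\<Sum>i\<le>length ss. if i = 0 then A ss else 0)"
    unfolding mould_mult_def
    by (rule sum.cong) (auto simp: mould_eval_unit mould_eval_gen_word[OF assms])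
  then show "mould_mult mould_unit A ss = A ss" by simp
qed

text \<open>A linear map whose difference with the identity raises the depth is invertible: the
  equation \<open>f M = C\<close> is solved by successive approximation, one depth at a time.\<close>

lemma unipotent_bij:
  fixes f :: "'g mould \<Rightarrow> 'g mould"
  assumes closed: "\<And>M. M \<in> BIMU \<Gamma> \<Longrightarrow> f M \<in> BIMU \<Gamma>"
    and add: "\<And>M N. M \<in> BIMU \<Gamma> \<Longrightarrow> N \<in> BIMU \<Gamma> \<Longrightarrow> f (M + N) = f M + f N"
    and lead: "\<And>M ss. M \<in> BIMU \<Gamma> \<Longrightarrow> (\<And>ts. length ts < length ss \<Longrightarrow> M ts = 0) \<Longrightarrow> f M ss = M ss"
  shows "bij_betw f (BIMU \<Gamma>) (BIMU \<Gamma>)"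
  unfolding bij_betw_def
proof
  have diff: "f (M - N) = f M - f N" if "M \<in> BIMU \<Gamma>" "N \<in> BIMU \<Gamma>" for M N
    using add[OF BIMU_diff[OF that] that(2)] by (simp add: algebra_simps)
  show "inj_on f (BIMU \<Gamma>)"
  proof (rule inj_onI)
    fix M N assume MN: "M \<in> BIMU \<Gamma>" "N \<in> BIMU \<Gamma>" "f M = f N"
    \<comment> \<open>Once \<open>M - N\<close> vanishes in smaller depths, \<open>lead\<close>
      identifies its value at \<open>ss\<close> with that of \<open>f M - f N\<close>, which is
      0.\<close>
    have "(M - N) ss = 0" for ss
    proof (induction ss rule: length_induct)
      case (1 ss)
      then have "f (M - N) ss = (M - N) ss" by (intro lead BIMU_diff MN) blast
      with MN diff show ?case by simp
    qed
    then show "M = N" by (auto simp: fun_eq_iff)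
  qed
  show "f ` BIMU \<Gamma> = BIMU \<Gamma>"
  proof
    show "f ` BIMU \<Gamma> \<subseteq> BIMU \<Gamma>" using closed by blast
    show "BIMU \<Gamma> \<subseteq> f ` BIMU \<Gamma>"
    proof
      fix C assume C: "C \<in> BIMU \<Gamma>"
      \<comment> \<open>Each iterate adds the current error. As the error of \<open>A n\<close>
        vanishes in depths below \<open>n\<close>, \<open>f\<close> fixes its part of depth
        \<open>n\<close>, so the next iterate is correct in that depth too.\<close>
      define A where "A = rec_nat 0 (\<lambda>_ M. M + (C - f M))"
      have A_0: "A 0 = 0" and A_Suc: "A (Suc n) = A n + (C - f (A n))" for n
        by (simp_all add: A_def)
      have A_BIMU: "A n \<in> BIMU \<Gamma>" for n
        by (induction n)
          (simp_all only: A_0 A_Suc BIMU_0 BIMU_add[OF _ BIMU_diff[OF C closed]])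
      have E_BIMU: "C - f (A n) \<in> BIMU \<Gamma>" for n by (intro BIMU_diff C closed A_BIMU)
      have solved: "length ss < n \<Longrightarrow> f (A n) ss = C ss" for n ss
      proof (induction n arbitrary: ss)
        case (Suc n)
        have "f (C - f (A n)) ss = (C - f (A n)) ss"
          using Suc by (intro lead E_BIMU) simp
        then show ?case unfolding A_Suc add[OF A_BIMU E_BIMU] by simp
      qed simp
      have stable: "length ss < n \<Longrightarrow> n \<le> m \<Longrightarrow> A m ss = A n ss" for n m ss
      proof (induction m)
        case (Suc m)
        then show ?case
          by (cases "n = Suc m") (simp_all add: A_Suc solved)
      qed simp
      \<comment> \<open>Values stop changing once their depth is solved; \<open>Suc\<close> appears
        because \<open>A n\<close> solves only depths strictly below \<open>n\<close>.\<close>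
      define M where "M ss = A (Suc (length ss)) ss" for ss
      have M: "M \<in> BIMU \<Gamma>"
        by (rule BIMU_I)
          (simp_all add: M_def BIMU_in_first[OF A_BIMU] BIMU_outside[OF A_BIMU])
      have "f M ss = C ss" for ss
      proof -
        \<comment> \<open>\<open>M\<close> and this iterate agree up to the depth of
          \<open>ss\<close>, so by \<open>lead\<close> their images under \<open>f\<close> agree at
          \<open>ss\<close>.\<close>
        let ?N = "A (Suc (length ss))"
        have zero: "(M - ?N) ts = 0" if "length ts \<le> length ss" for ts
          using stable[of ts "Suc (length ts)" "Suc (length ss)"] that by (simp add: M_def)
        have "f (M - ?N) ss = (M - ?N) ss"
          by (intro lead BIMU_diff M A_BIMU zero) simp
        with zero[of ss] show ?thesis by (simp add: diff[OF M A_BIMU] solved)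
      qed
      then have "f M = C" ..
      with M show "C \<in> f ` BIMU \<Gamma>" by blast
    qed
  qed
qed

section \<open>Inverses and the group structure on \<open>GARI\<close>\<close>

lemma mould_left_inverse:
  assumes B: "B \<in> GARI \<Gamma>"
  shows "\<exists>A\<in>GARI \<Gamma>. mould_mult A B = mould_unit"
proof -
  have B': "B \<in> BIMU \<Gamma>" "B [] = 1" using B by (auto simp: GARI_def)
  have "bij_betw (\<lambda>A. mould_mult A B) (BIMU \<Gamma>) (BIMU \<Gamma>)"
  proof (rule unipotent_bij)
    fix M :: "'a mould" and ss :: "'a list"
    assume M: "M \<in> BIMU \<Gamma>" and zero: "\<And>ts. length ts < length ss \<Longrightarrow> M ts = 0"
    \<comment> \<open>Every cut with a nonempty right part sees \<open>M\<close> in smaller depth,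
      where it vanishes; the remaining cut has the weight \<open>B [] = 1\<close>.\<close>
    have "mould_mult M B ss = (\<Sum>i\<le>length ss. if i = length ss then M ss else 0)"
      unfolding mould_mult_def
    proof (rule sum.cong)
      fix i assume i: "i \<in> {..length ss}"
      have "mould_eval M (take i (gen_word ss)) = 0" if "i \<noteq> length ss"
        by (rule mould_eval_0, rule zero) (use i that in simp)
      then show "mould_eval M (take i (gen_word ss)) * mould_eval B (drop i (gen_word ss))
          = (if i = length ss then M ss else 0)"
        by (simp add: mould_eval_Nil[OF B'(1)] B'(2) mould_eval_gen_word[OF M])
    qed simp
    then show "mould_mult M B ss = M ss" by simp
  qed (simp_all add: BIMU_mult B' mould_mult_add_left)
  then obtain A where A: "A \<in> BIMU \<Gamma>" "mould_mult A B = mould_unit"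
    using BIMU_unit unfolding bij_betw_def by (metis imageE)
  then have "A [] = 1"
    using mould_mult_Nil[OF A(1) B'(1)] B'(2) by (simp add: mould_unit_def)
  with A show ?thesis by (auto simp: GARI_def)
qed

text \<open>\<open>groupI\<close> asks only for a left unit and left inverses.\<close>

lemma group_GARI: "group (GARI_group \<Gamma>)"
proof (rule groupI)
  fix A assume "A \<in> carrier (GARI_group \<Gamma>)"
  then show "\<exists>A'\<in>carrier (GARI_group \<Gamma>). A' \<otimes>\<^bsub>GARI_group \<Gamma>\<^esub> A = \<one>\<^bsub>GARI_group \<Gamma>\<^esub>"
    using mould_left_inverse by (simp add: GARI_group_def)
qed (auto simp: GARI_group_def GARI_def BIMU_mult BIMU_unit mould_mult_Nil mould_mult_assoc
    mould_mult_unit_left mould_unit_Nil)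

section \<open>The Lie algebra structure on \<open>ARI\<close>\<close>

interpretation mould: vector_space mould_scale
  by unfold_locales
    (auto simp: mould_scale_def fun_eq_iff algebra_simps const_ratfun_add const_ratfun_mult)

lemma ARI_BIMU: "A \<in> ARI \<Gamma> \<Longrightarrow> A \<in> BIMU \<Gamma>"
  by (simp add: ARI_def)

text \<open>The commutator of an associative product is a Lie bracket; it stays in
  \<open>ARI\<close> because products of elements of \<open>ARI\<close> vanish at the empty
  word.\<close>

lemma lie_algebra_ARI: "lie_algebra_on mould_scale mould_bracket (ARI \<Gamma>)"
proof
  show "mould.subspace (ARI \<Gamma>)"
    by (rule mould.subspaceI)
      (auto simp: ARI_def BIMU_0 BIMU_add BIMU_scale, simp add: mould_scale_def)
next
  fix x y assume "x \<in> ARI \<Gamma>" "y \<in> ARI \<Gamma>"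
  then show "mould_bracket x y \<in> ARI \<Gamma>"
    by (auto simp: ARI_def mould_bracket_def BIMU_diff BIMU_mult mould_mult_Nil)
next
  fix x y z assume "x \<in> ARI \<Gamma>" "y \<in> ARI \<Gamma>" "z \<in> ARI \<Gamma>"
  note B = this[THEN ARI_BIMU]
  show "mould_bracket (x + y) z = mould_bracket x z + mould_bracket y z"
    by (simp add: mould_bracket_def mould_mult_add_left[OF B(1,2)] mould_mult_add_right[OF B(1,2)])
  show "mould_bracket x (y + z) = mould_bracket x y + mould_bracket x z"
    by (simp add: mould_bracket_def mould_mult_add_left[OF B(2,3)] mould_mult_add_right[OF B(2,3)])
  show "mould_bracket x (mould_bracket y z) + mould_bracket y (mould_bracket z x)
      + mould_bracket z (mould_bracket x y) = 0"
    using B by (simp add: mould_bracket_def mould_mult_diff_left[of _ \<Gamma>]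
        mould_mult_diff_right[of _ \<Gamma>] mould_mult_assoc[of _ \<Gamma>] BIMU_mult)
next
  fix x y c assume "x \<in> ARI \<Gamma>" "y \<in> ARI \<Gamma>"
  note B = this[THEN ARI_BIMU]
  show "mould_bracket (mould_scale c x) y = mould_scale c (mould_bracket x y)"
    by (simp add: mould_bracket_def mould_mult_scale_left[OF B(1)] mould_mult_scale_right[OF B(1)]
        mould.scale_right_diff_distrib)
  show "mould_bracket x (mould_scale c y) = mould_scale c (mould_bracket x y)"
    by (simp add: mould_bracket_def mould_mult_scale_left[OF B(2)] mould_mult_scale_right[OF B(2)]
        mould.scale_right_diff_distrib)
qed (simp add: mould_bracket_def)

section \<open>The map ganit\<close>

definition contract :: "('g, 'x) monoid_scheme \<Rightarrow> 'g \<times> linform \<Rightarrow> 'g word \<Rightarrow> 'g \<times> linform" where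
  "contract \<Gamma> x b = (foldl (\<lambda>y z. y \<otimes>\<^bsub>\<Gamma>\<^esub> z) (fst x) (map fst b), snd x)"

lemma snd_contract [simp]: "snd (contract \<Gamma> x b) = snd x"
  by (simp add: contract_def)

lemma contract_Nil [simp]: "contract \<Gamma> x [] = x"
  by (simp add: contract_def)

text \<open>Single letters suffice as left factors because \<open>flex_right\<close> looks only at
  the last letter of its first argument and \<open>flex_left\<close> changes only that
  letter.\<close>

abbreviation ganit_sum ::
    "('g, 'x) monoid_scheme \<Rightarrow> 'g mould \<Rightarrow> 'g word \<Rightarrow> ('g word \<Rightarrow> ratfun) \<Rightarrow> ratfun" where
  "ganit_sum \<Gamma> B \<equiv> flex_sum (\<lambda>x b. mould_eval B (flex_right [x] b)) (contract \<Gamma>)"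

text \<open>Allowing the empty list gives the empty word one factorisation, matching the base case
  of \<open>flex_sum\<close>.\<close>

definition flex_facts0 :: "'g word \<Rightarrow> ('g word \<times> 'g word) list set" where
  "flex_facts0 w = {fs. concat (map (\<lambda>(a, b). a @ b) fs) = w \<and>
     (\<forall>(a, b) \<in> set fs. a \<noteq> []) \<and> (\<forall>(a, b) \<in> set (butlast fs). b \<noteq> [])}"

lemma flex_facts0_Nil: "flex_facts0 [] = {[]}"
proof -
  have "fs = []" if "fs \<in> flex_facts0 []" for fs :: "('g word \<times> 'g word) list"
    using that by (cases fs) (auto simp: flex_facts0_def)
  then show ?thesis by (auto simp: flex_facts0_def)
qed

lemma flex_facts0_eq: "w \<noteq> [] \<Longrightarrow> flex_facts0 w = flex_facts w"
  by (auto simp: flex_facts0_def flex_facts_def)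

lemma finite_flex_facts0: "finite (flex_facts0 w)"
  by (cases "w = []") (simp_all add: flex_facts0_Nil flex_facts0_eq finite_flex_facts)

text \<open>Adds a first letter that absorbs nothing: it joins the first left factor, or forms a
  factor with empty right part when nothing follows.\<close>

definition extend_head :: "'a \<Rightarrow> ('a list \<times> 'a list) list \<Rightarrow> ('a list \<times> 'a list) list" where
  "extend_head x fs = (case fs of [] \<Rightarrow> [([x], [])] | (a, b) # r \<Rightarrow> (x # a, b) # r)"

text \<open>The first letter either absorbs nothing, which is the case of
  \<open>extend_head\<close>, or is a left factor on its own followed by a nonempty right factor of
  length \<open>k\<close>; hence \<open>k\<close> starts at 1.\<close>

lemma flex_facts0_Cons:
  "flex_facts0 (x # u) = extend_head x ` flex_facts0 u \<union>
     (\<Union>k\<in>{1..length u}. (#) ([x], take k u) ` flex_facts0 (drop k u))"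
  (is "_ = ?R")
proof
  show "flex_facts0 (x # u) \<subseteq> ?R"
  proof
    fix fs assume fs: "fs \<in> flex_facts0 (x # u)"
    then obtain a b r where r: "fs = (x # a, b) # r" and u: "u = a @ b @ concat (map (\<lambda>(a, b). a @ b) r)"
      by (cases fs; cases "fst (hd fs)") (auto simp: flex_facts0_def)
    show "fs \<in> ?R"
    proof (cases "a = []")
      case False
      then have "(a, b) # r \<in> flex_facts0 u"
        using fs by (auto simp: flex_facts0_def r u split: if_splits)
      then have "extend_head x ((a, b) # r) \<in> ?R" by blast
      then show ?thesis by (simp add: extend_head_def r)
    next
      case a: True
      show ?thesis
      proof (cases "b = []")
        case True
        \<comment> \<open>An empty right factor is allowed only at the end.\<close>
        then have "r = []" using fs by (auto simp: flex_facts0_def r split: if_splits)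
        with a True show ?thesis
          by (simp add: r u flex_facts0_Nil extend_head_def)
      next
        case False
        have "r \<in> flex_facts0 (drop (length b) u)"
          using fs by (auto simp: flex_facts0_def r u a split: if_splits)
        then have "([x], take (length b) u) # r \<in> ?R"
          using False by (intro UnI2 UN_I[of "length b"]) (auto simp: u a Suc_le_eq)
        then show ?thesis by (simp add: r u a)
      qed
    qed
  qed
next
  have "extend_head x fs \<in> flex_facts0 (x # u)" if "fs \<in> flex_facts0 u" for fs
    using that by (cases fs) (auto simp: extend_head_def flex_facts0_def split: if_splits)
  moreover have "([x], take k u) # r \<in> flex_facts0 (x # u)"
    if "r \<in> flex_facts0 (drop k u)" "k \<in> {1..length u}" for r k
    using that by (auto simp: flex_facts0_def)
  ultimately show "?R \<subseteq> flex_facts0 (x # u)" by blast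
qed

lemma flex_left_Cons: "a \<noteq> [] \<Longrightarrow> flex_left \<Gamma> (x # a) b = x # flex_left \<Gamma> a b"
  by (simp add: flex_left_def)

lemma flex_left_single: "flex_left \<Gamma> [x] b = [contract \<Gamma> x b]"
  by (simp add: flex_left_def contract_def)

lemma flex_right_Cons: "a \<noteq> [] \<Longrightarrow> flex_right (x # a) b = flex_right a b"
  by (simp add: flex_right_def)

lemma flex_right_Nil [simp]: "flex_right a [] = []"
  by (simp add: flex_right_def)

text \<open>Factorisations are split by what the first letter absorbs. Those from
  \<open>extend_head\<close> give the term \<open>k = 0\<close> of the recursion, whose weight is
  the value 1 of \<open>B\<close> at the empty word; the others give the terms with
  \<open>k \<ge> 1\<close>.\<close>

lemma flex_facts_sum:
  assumes B: "mould_eval B [] = 1"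
  shows "(\<Sum>fs\<in>flex_facts0 w. prod_list (map (\<lambda>(a, b). mould_eval B (flex_right a b)) fs) *
      \<phi> (concat (map (\<lambda>(a, b). flex_left \<Gamma> a b) fs))) = ganit_sum \<Gamma> B w \<phi>"
proof (induction "length w" arbitrary: w \<phi> rule: less_induct)
  case less
  define T where "T \<phi> fs = prod_list (map (\<lambda>(a, b). mould_eval B (flex_right a b)) fs) *
      \<phi> (concat (map (\<lambda>(a, b). flex_left \<Gamma> a b) fs))" for \<phi> :: "'a word \<Rightarrow> ratfun" and fs
  have IH: "sum (T \<phi>) (flex_facts0 v) = ganit_sum \<Gamma> B v \<phi>" if "length v < length w" for v \<phi>
    unfolding T_def by (rule less[OF that])
  show ?case
  proof (cases w)
    case Nil
    then show ?thesis by (simp add: flex_facts0_Nil)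
  next
    case w: (Cons x u)
    let ?P = "\<lambda>k. (#) ([x], take k u) ` flex_facts0 (drop k u)"
    let ?\<beta> = "\<lambda>k. mould_eval B (flex_right [x] (take k u))"
    have nonempty: "fst (hd fs) \<noteq> []" if "fs \<in> flex_facts0 u" "fs \<noteq> []" for fs
      using that by (cases fs) (auto simp: flex_facts0_def)
    have inj: "inj_on (extend_head x) (flex_facts0 u)"
      by (rule inj_onI) (use nonempty in \<open>fastforce simp: extend_head_def split: list.splits\<close>)
    \<comment> \<open>Lengthening a left factor at the front leaves its weight unchanged; a newly
      created factor has weight 1.\<close>
    have T_extend: "T \<phi> (extend_head x fs) = T (\<lambda>v. \<phi> (x # v)) fs" if "fs \<in> flex_facts0 u" for fs
      using nonempty[OF that]
      by (cases fs) (auto simp: T_def extend_head_def flex_left_Cons flex_right_Cons B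
          flex_left_single)
    have T_Cons: "T \<phi> (([x], b) # r) =
        mould_eval B (flex_right [x] b) * T (\<lambda>v. \<phi> (contract \<Gamma> x b # v)) r" for b r
      by (simp add: T_def flex_left_single mult_ac)
    \<comment> \<open>The first factor of \<open>extend_head x fs\<close> has at least two letters
      on the left or is \<open>([x], [])\<close>, whereas \<open>take k u\<close> is nonempty
      here.\<close>
    have "extend_head x fs \<noteq> ([x], take k u) # r"
      if "fs \<in> flex_facts0 u" "k \<in> {1..length u}" for fs k r
      using nonempty[OF that(1)] that(2) by (cases fs) (auto simp: extend_head_def)
    then have disj: "extend_head x ` flex_facts0 u \<inter> (\<Union>k\<in>{1..length u}. ?P k) = {}" by blast
    have "sum (T \<phi>) (flex_facts0 w) =
        sum (T \<phi>) (extend_head x ` flex_facts0 u) + sum (T \<phi>) (\<Union>k\<in>{1..length u}. ?P k)"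
      unfolding w flex_facts0_Cons
      by (rule sum.union_disjoint[OF _ _ disj]) (simp_all add: finite_flex_facts0)
    also have "sum (T \<phi>) (extend_head x ` flex_facts0 u) = ganit_sum \<Gamma> B u (\<lambda>v. \<phi> (x # v))"
      using IH[of u "\<lambda>v. \<phi> (x # v)"] by (simp add: sum.reindex[OF inj] T_extend w)
    also have "sum (T \<phi>) (\<Union>k\<in>{1..length u}. ?P k) = (\<Sum>k\<in>{1..length u}. sum (T \<phi>) (?P k))"
    proof (rule sum.UNION_disjoint)
      show "\<forall>i\<in>{1..length u}. \<forall>j\<in>{1..length u}. i \<noteq> j \<longrightarrow> ?P i \<inter> ?P j = {}"
        by (auto dest: arg_cong[of _ _ length])
    qed (simp_all add: finite_flex_facts0)
    also have "\<dots> = (\<Sum>k\<in>{1..length u}. ?\<beta> k *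
        ganit_sum \<Gamma> B (drop k u) (\<lambda>v. \<phi> (contract \<Gamma> x (take k u) # v)))"
    proof (rule sum.cong)
      fix k
      show "sum (T \<phi>) (?P k) =
          ?\<beta> k * ganit_sum \<Gamma> B (drop k u) (\<lambda>v. \<phi> (contract \<Gamma> x (take k u) # v))"
        using IH[of "drop k u" "\<lambda>v. \<phi> (contract \<Gamma> x (take k u) # v)"]
        by (simp add: sum.reindex T_Cons w flip: sum_distrib_left)
    qed simp
    also have "ganit_sum \<Gamma> B u (\<lambda>v. \<phi> (x # v)) + \<dots> = ganit_sum \<Gamma> B w \<phi>"
      by (simp add: w atMost_atLeast0 sum.atLeast_Suc_atMost B)
    finally show ?thesis unfolding T_def .
  qed
qed

section \<open>The map \<open>ganit_v\<close> at independent words\<close>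

lemma mould_eval_GARI_Nil: "B \<in> GARI \<Gamma> \<Longrightarrow> mould_eval B [] = 1"
  using mould_eval_Nil[of B \<Gamma>] by (simp add: GARI_def)

text \<open>At the empty word \<open>flex_facts\<close> is empty; there the separate clause of
  \<open>ganit_v\<close> gives the value of the recursive sum.\<close>

lemma ganit_v_eq:
  assumes "A \<in> BIMU \<Gamma>" "B \<in> GARI \<Gamma>" "set ss \<subseteq> carrier \<Gamma>"
  shows "ganit_v \<Gamma> B A ss = ganit_sum \<Gamma> B (gen_word ss) (mould_eval A)"
proof (cases "ss = []")
  case True
  then show ?thesis using assms by (simp add: ganit_v_def mould_eval_Nil gen_word_def)
next
  case False
  from flex_facts_sum[OF mould_eval_GARI_Nil[OF assms(2)], where w = "gen_word ss"
      and \<phi> = "mould_eval A"] False assms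
  show ?thesis
    by (simp add: ganit_v_def flex_facts0_eq)
qed

lemma ganit_v_outside: "\<not> set ss \<subseteq> carrier \<Gamma> \<Longrightarrow> ganit_v \<Gamma> B A ss = 0"
  by (auto simp: ganit_v_def)

lemma ganit_v_Nil [simp]: "ganit_v \<Gamma> B A [] = A []"
  by (simp add: ganit_v_def)

lemma indep_flex_right:
  assumes "indep (map snd (x # b))"
  shows "indep (map snd (flex_right [x] b))"
proof -
  have "map snd (flex_right [x] b) = map (\<lambda>z. z - snd x) (map snd b)"
    by (simp add: flex_right_def case_prod_beta)
  with indep_diff[of "snd x" "map snd b"] assms show ?thesis by simp
qed

text \<open>With equality as both relations in \<open>flex_sum_rel\<close>, the two functions are
  compared only at words whose forms are subsequences of those of \<open>w\<close>, hence
  independent.\<close>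

lemma ganit_sum_cong:
  assumes w: "indep (map snd w)"
    and eq: "\<And>v. indep (map snd v) \<Longrightarrow> \<phi> v = \<psi> v"
  shows "ganit_sum \<Gamma> B w \<phi> = ganit_sum \<Gamma> B w \<psi>"
  by (rule flex_sum_rel[where L = "(=)" and Q = "(=)"])
    (auto simp: list.rel_eq intro: eq indep_subseq[OF w])

text \<open>Both flexions commute with substitution: one multiplies group entries only, the other
  takes differences of forms, which substitution respects.\<close>

lemma ganit_sum_subst:
  assumes A: "A \<in> BIMU \<Gamma>" and B: "B \<in> BIMU \<Gamma>"
    and w: "indep (map snd w)" and w': "indep (map snd w')"
    and rel: "list_all2 (letter_subst s) w w'"
  shows "subst_to s (ganit_sum \<Gamma> B w (mould_eval A)) (ganit_sum \<Gamma> B w' (mould_eval A))"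
proof (rule flex_sum_rel[where L = "letter_subst s" and Q = "subst_to s"])
  fix x x' :: "'a \<times> linform" and b b' :: "'a word"
  assume x: "letter_subst s x x'" and b: "list_all2 (letter_subst s) b b'"
  show "letter_subst s (contract \<Gamma> x b) (contract \<Gamma> x' b')"
    using x letter_subst_map_fst[OF b] by (simp add: letter_subst_def contract_def)
  assume sub: "subseq (map snd (x # b)) (map snd w)" "subseq (map snd (x' # b')) (map snd w')"
  have "list_all2 (letter_subst s) (flex_right [x] b) (flex_right [x'] b')"
    using x b by (auto simp: flex_right_def list_all2_conv_all_nth letter_subst_def case_prod_beta
        linform_poly_diff poly_subst_diff)
  then show "subst_to s (mould_eval B (flex_right [x] b)) (mould_eval B (flex_right [x'] b'))"
    using indep_subseq[OF w sub(1)] indep_subseq[OF w' sub(2)]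
    by (intro mould_eval_subst[OF B] indep_flex_right)
qed (auto intro: subst_to_0 subst_to_add subst_to_mult rel mould_eval_subst[OF A]
    indep_subseq[OF w] indep_subseq[OF w'])

text \<open>The transfer principle applied to the flexion sum, which gives the components of
  \<open>ganit_v\<close> at tuples inside the carrier.\<close>

lemma mould_eval_ganit_v:
  assumes A: "A \<in> BIMU \<Gamma>" and B: "B \<in> GARI \<Gamma>"
    and w: "indep (map snd w)" "set (map fst w) \<subseteq> carrier \<Gamma>"
  shows "mould_eval (ganit_v \<Gamma> B A) w = ganit_sum \<Gamma> B w (mould_eval A)"
proof (rule mould_eval_equivariant)
  have B': "B \<in> BIMU \<Gamma>" using B by (simp add: GARI_def)
  show "ganit_v \<Gamma> B A (map fst w) = ganit_sum \<Gamma> B (gen_word (map fst w)) (mould_eval A)"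
    by (rule ganit_v_eq[OF A B w(2)])
  show "subst_to (word_subst w) (ganit_sum \<Gamma> B (gen_word (map fst w)) (mould_eval A))
      (ganit_sum \<Gamma> B w (mould_eval A))"
    by (rule ganit_sum_subst[OF A B' indep_gen_word w(1) letter_subst_gen_word])
qed

lemma ganit_v_BIMU:
  assumes A: "A \<in> BIMU \<Gamma>" and B: "B \<in> GARI \<Gamma>"
  shows "ganit_v \<Gamma> B A \<in> BIMU \<Gamma>"
proof (rule BIMU_I)
  fix ss :: "'a list"
  let ?n = "length ss" and ?w = "gen_word ss"
  \<comment> \<open>Equality of letters together with a bound on their variables makes
    \<open>flex_sum_rel\<close> prove an invariant; \<open>Q\<close> below ignores its second
    argument.\<close>
  let ?L = "\<lambda>x y. x = y \<and> linform_poly (snd x) \<in> poly_in_first ?n"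
  have B': "B \<in> BIMU \<Gamma>" using B by (simp add: GARI_def)
  have L: "list_all2 ?L v v' \<longleftrightarrow> v = v' \<and> (\<forall>x\<in>set v. linform_poly (snd x) \<in> poly_in_first ?n)"
    for v v' :: "'a word"
    by (induction v arbitrary: v') (auto simp: list_all2_Cons1)
  show "ganit_v \<Gamma> B A ss \<in> ratfun_in_first ?n"
  proof (cases "set ss \<subseteq> carrier \<Gamma>")
    case True
    have "ganit_sum \<Gamma> B ?w (mould_eval A) \<in> ratfun_in_first ?n"
    proof (rule flex_sum_rel[where L = ?L and Q = "\<lambda>f _. f \<in> ratfun_in_first ?n"
          and w' = ?w and \<phi>' = "mould_eval A"])
      fix x x' :: "'a \<times> linform" and b b' :: "'a word"
      assume x: "?L x x'" and b: "list_all2 ?L b b'"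
        and sub: "subseq (map snd (x # b)) (map snd ?w)"
      show "mould_eval B (flex_right [x] b) \<in> ratfun_in_first ?n"
        using x b indep_subseq[OF indep_gen_word sub]
        by (intro mould_eval_in_first[OF B'] indep_flex_right)
          (auto simp: L flex_right_def linform_poly_diff intro!: poly_in_first_diff)
    next
      fix v v' :: "'a word"
      assume "list_all2 ?L v v'" "subseq (map snd v) (map snd ?w)"
      then show "mould_eval A v \<in> ratfun_in_first ?n"
        by (intro mould_eval_in_first[OF A] indep_subseq[OF indep_gen_word]) (auto simp: L)
    qed (auto simp: L gen_word_in_first intro: ratfun_in_first_add ratfun_in_first_mult)
    then show ?thesis by (simp add: ganit_v_eq[OF A B True])
  qed (simp add: ganit_v_outside)
qed (simp add: ganit_v_outside)

section \<open>Linearity, multiplicativity and bijectivity of \<open>ganit_v\<close>\<close>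

lemma ganit_v_add:
  assumes "A \<in> BIMU \<Gamma>" "A' \<in> BIMU \<Gamma>" "B \<in> GARI \<Gamma>"
  shows "ganit_v \<Gamma> B (A + A') = ganit_v \<Gamma> B A + ganit_v \<Gamma> B A'"
proof
  fix ss :: "'a list"
  have "ganit_sum \<Gamma> B (gen_word ss) (mould_eval (A + A'))
      = ganit_sum \<Gamma> B (gen_word ss) (\<lambda>v. mould_eval A v + mould_eval A' v)"
    by (rule ganit_sum_cong[OF indep_gen_word]) (rule mould_eval_add[OF assms(1,2)])
  then show "ganit_v \<Gamma> B (A + A') ss = (ganit_v \<Gamma> B A + ganit_v \<Gamma> B A') ss"
    by (cases "set ss \<subseteq> carrier \<Gamma>")
      (simp_all add: ganit_v_eq[of _ \<Gamma>] assms BIMU_add ganit_v_outside flex_sum_add)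
qed

lemma ganit_v_diff:
  assumes "A \<in> BIMU \<Gamma>" "A' \<in> BIMU \<Gamma>" "B \<in> GARI \<Gamma>"
  shows "ganit_v \<Gamma> B (A - A') = ganit_v \<Gamma> B A - ganit_v \<Gamma> B A'"
  using ganit_v_add[OF BIMU_diff[OF assms(1,2)] assms(2,3)] by (simp add: algebra_simps)

lemma ganit_v_scale:
  assumes "A \<in> BIMU \<Gamma>" "B \<in> GARI \<Gamma>"
  shows "ganit_v \<Gamma> B (mould_scale c A) = mould_scale c (ganit_v \<Gamma> B A)"
proof
  fix ss :: "'a list"
  have "ganit_sum \<Gamma> B (gen_word ss) (mould_eval (mould_scale c A))
      = ganit_sum \<Gamma> B (gen_word ss) (\<lambda>v. const_ratfun c * mould_eval A v)"
    by (rule ganit_sum_cong[OF indep_gen_word]) (rule mould_eval_scale[OF assms(1)])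
  then show "ganit_v \<Gamma> B (mould_scale c A) ss = mould_scale c (ganit_v \<Gamma> B A) ss"
    by (cases "set ss \<subseteq> carrier \<Gamma>")
      (simp_all add: ganit_v_eq[of _ \<Gamma>] assms BIMU_scale ganit_v_outside flex_sum_scale
        mould_scale_def[of c "ganit_v \<Gamma> B A"])
qed

text \<open>\<open>flex_sum_conv\<close> distributes the sum over the cuts of the generic word;
  prefixes and suffixes are independent, so the two factors are values of
  \<open>ganit_v\<close>.\<close>

lemma ganit_v_mult:
  assumes A: "A \<in> BIMU \<Gamma>" and A': "A' \<in> BIMU \<Gamma>" and B: "B \<in> GARI \<Gamma>"
  shows "ganit_v \<Gamma> B (mould_mult A A') = mould_mult (ganit_v \<Gamma> B A) (ganit_v \<Gamma> B A')"
proof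
  fix ss :: "'a list"
  show "ganit_v \<Gamma> B (mould_mult A A') ss = mould_mult (ganit_v \<Gamma> B A) (ganit_v \<Gamma> B A') ss"
  proof (cases "set ss \<subseteq> carrier \<Gamma>")
    case True
    let ?w = "gen_word ss"
    have fst: "set (map fst (take i ?w)) \<subseteq> carrier \<Gamma>" "set (map fst (drop i ?w)) \<subseteq> carrier \<Gamma>" for i
      using True set_take_subset[of i ss] set_drop_subset[of i ss]
      by (simp_all flip: take_map drop_map del: set_map)
    have "ganit_v \<Gamma> B (mould_mult A A') ss = ganit_sum \<Gamma> B ?w (mould_eval (mould_mult A A'))"
      by (rule ganit_v_eq[OF BIMU_mult[OF A A'] B True])
    also have "\<dots> = ganit_sum \<Gamma> B ?w (conv (mould_eval A) (mould_eval A'))"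
      by (rule ganit_sum_cong[OF indep_gen_word mould_eval_mult[OF A A']])
    also have "\<dots> = conv (\<lambda>v. ganit_sum \<Gamma> B v (mould_eval A))
        (\<lambda>v. ganit_sum \<Gamma> B v (mould_eval A')) ?w"
      by (rule flex_sum_conv)
    also have "\<dots> = mould_mult (ganit_v \<Gamma> B A) (ganit_v \<Gamma> B A') ss"
      unfolding mould_mult_conv[of _ _ ss]
      by (rule conv_cong)
        (simp_all only: mould_eval_ganit_v[OF A B indep_take[OF indep_gen_word] fst(1)]
          mould_eval_ganit_v[OF A' B indep_drop[OF indep_gen_word] fst(2)])
    finally show ?thesis .
  next
    case False
    then show ?thesis
      by (simp add: ganit_v_outside BIMU_outside[OF BIMU_mult[OF ganit_v_BIMU[OF A B]
            ganit_v_BIMU[OF A' B]]])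
  qed
qed

text \<open>\<open>flex_sum_leading\<close> provides the leading-term hypothesis of
  \<open>unipotent_bij\<close>.\<close>

lemma ganit_v_bij_BIMU:
  assumes B: "B \<in> GARI \<Gamma>"
  shows "bij_betw (ganit_v \<Gamma> B) (BIMU \<Gamma>) (BIMU \<Gamma>)"
proof (rule unipotent_bij)
  fix M :: "'a mould" and ss :: "'a list"
  assume M: "M \<in> BIMU \<Gamma>" and zero: "\<And>ts. length ts < length ss \<Longrightarrow> M ts = 0"
  show "ganit_v \<Gamma> B M ss = M ss"
  proof (cases "set ss \<subseteq> carrier \<Gamma>")
    case True
    have "ganit_sum \<Gamma> B (gen_word ss) (mould_eval M) = mould_eval M (gen_word ss)"
      by (intro flex_sum_leading) (auto simp: mould_eval_GARI_Nil[OF B] intro!: mould_eval_0 zero)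
    with M show ?thesis by (simp add: ganit_v_eq[OF M B True] mould_eval_gen_word[OF M])
  qed (simp add: ganit_v_outside BIMU_outside[OF M])
qed (simp_all add: ganit_v_BIMU ganit_v_add B)

text \<open>The value at the empty word is fixed, so images and preimages stay in their level. The
  levels 1 and 0 are \<open>GARI\<close> and \<open>ARI\<close>.\<close>

lemma ganit_v_bij_level:
  assumes B: "B \<in> GARI \<Gamma>"
  shows "bij_betw (ganit_v \<Gamma> B) {M \<in> BIMU \<Gamma>. M [] = c} {M \<in> BIMU \<Gamma>. M [] = c}"
  using ganit_v_bij_BIMU[OF B] unfolding bij_betw_def
  by (intro conjI) (auto intro: inj_on_subset simp: image_iff set_eq_iff, metis ganit_v_Nil)

theorem theorem3p7:
  fixes \<Gamma> :: "('g, 'x) monoid_scheme" and B :: "'g mould"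
  assumes "comm_group \<Gamma>" and "finite (carrier \<Gamma>)"
    and "B \<in> GARI \<Gamma>"
  shows "linear_map_on mould_scale (BIMU \<Gamma>) (BIMU \<Gamma>) (ganit_v \<Gamma> B)
    \<and> group (GARI_group \<Gamma>) \<and> ganit_v \<Gamma> B \<in> iso (GARI_group \<Gamma>) (GARI_group \<Gamma>)
    \<and> lie_automorphism_on mould_scale mould_bracket (ARI \<Gamma>) (ganit_v \<Gamma> B)"
proof (intro conjI)
  note B = assms(3)
  show "linear_map_on mould_scale (BIMU \<Gamma>) (BIMU \<Gamma>) (ganit_v \<Gamma> B)"
    by (auto simp: linear_map_on_def ganit_v_BIMU ganit_v_add ganit_v_scale B)
  show "group (GARI_group \<Gamma>)" by (rule group_GARI)
  have bij: "bij_betw (ganit_v \<Gamma> B) (GARI \<Gamma>) (GARI \<Gamma>)" "bij_betw (ganit_v \<Gamma> B) (ARI \<Gamma>) (ARI \<Gamma>)"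
    unfolding GARI_def ARI_def by (rule ganit_v_bij_level[OF B])+
  show "ganit_v \<Gamma> B \<in> iso (GARI_group \<Gamma>) (GARI_group \<Gamma>)"
    using bij(1) by (auto simp: iso_def hom_def GARI_group_def ganit_v_mult[OF _ _ B] GARI_def
        ganit_v_BIMU[OF _ B])
  show "lie_automorphism_on mould_scale mould_bracket (ARI \<Gamma>) (ganit_v \<Gamma> B)"
    unfolding lie_automorphism_on_def linear_map_on_def
    using bij(2) lie_algebra_ARI
    by (auto simp: ARI_def ganit_v_BIMU ganit_v_add ganit_v_scale B mould_bracket_def
        BIMU_mult ganit_v_diff[of _ \<Gamma>] ganit_v_mult[of _ \<Gamma>])
qed

end
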